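(* Let $n\ge1$, and for $r=1,2$ let $\vec{\alpha_r}=(\alpha_{r1},\dots,\alpha_{rn})$ with all $\alpha_{ri}>0$, $\vec{p_r}=(p_{r1},\dots,p_{rn})$ with all $0<p_{ri}<1$, and $\vec{\beta_r}=(\beta_{r1},\dots,\beta_{rn})$ with all $\beta_{ri}>0$. Let $\mathcal{N}_r=\sum_{i=1}^n N_{\alpha_{ri},p_{ri}}$ and $\mathcal{G}_r=\sum_{i=1}^n G_{\alpha_{ri},\beta_{ri}}$, sums of independent negative binomial, resp. gamma, random variables. Then: (a) If $(\vec{\alpha_1},\log\vec{p_1})$ is smaller than $(\vec{\alpha_2},\log\vec{p_2})$ in the reverse-coupled weakly sub-sup majorization order, then $\mathcal{N}_1\le_{st}\mathcal{N}_2$. (b) If $(\vec{\alpha_1},\log\vec{\beta_1})$ is smaller than $(\vec{\alpha_2},\log\vec{\beta_2})$ in the reverse-coupled weakly sub-sup majorization order, then $\mathcal{G}_1\le_{st}\mathcal{G}_2$.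
   Context: For $\alpha>0$, $0<p<1$, $q=1-p$: $P(N_{\alpha,p}=k)=\binom{k+\alpha-1}{k}p^\alpha q^k$, $k=0,1,2,\dots$. For $\alpha,\beta>0$, $G_{\alpha,\beta}$ has density $\frac{\beta^\alpha t^{\alpha-1}}{\Gamma(\alpha)}e^{-\beta t}$ for $t\ge0$ and $0$ for $t<0$. $X_1\le_{st}X_2$ means $P(X_1\ge t)\le P(X_2\ge t)$ for all $t\in\mathbb{R}$. $\log\vec{x}=(\log x_1,\dots,\log x_n)$. For $\vec{x},\vec{y}\in\mathbb{R}^m$, $\vec{x}\prec\vec{y}$ (majorization) means that the sum of the $k$ largest components of $\vec{x}$ is at most that of $\vec{y}$ for $k=1,\dots,m$, with equality for $k=m$. Let $\mathcal{A}$ be the set of vector pairs $(\vec{x},\vec{y})\in\mathbb{R}^n\times\mathbb{R}^n$ modulo simultaneous permutation of the coordinates of $\vec x$ and $\vec y$ by the same permutation. The reverse-coupled weakly sub-sup majorization order is the order on $\mathcal{A}$ generated by the following relations, i.e. $(\vec{x},\vec{y})$ is smaller than $(\vec{x}',\vec{y}')$ if there is a finite chain of elements of $\mathcal{A}$ from $(\vec{x},\vec{y})$ to $(\vec{x}',\vec{y}')$ in which each consecutive pair $(\vec{x_1},\vec{y_1})$, $(\vec{x_2},\vec{y_2})$ satisfies one of: (i) for some $1\le i<j\le n$ with $(y_{2j}-y_{2i})(x_{2j}-x_{2i})\le0$: $(x_{1i},x_{1j})\prec(x_{2i},x_{2j})$, $x_{1m}=x_{2m}$ for $m\ne i,j$,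 and $\vec{y_1}=\vec{y_2}$; (ii) for some $1\le i<j\le n$ with $(y_{2j}-y_{2i})(x_{2j}-x_{2i})\le0$: $(y_{1i},y_{1j})\prec(y_{2i},y_{2j})$, $y_{1m}=y_{2m}$ for $m\ne i,j$, and $\vec{x_1}=\vec{x_2}$; (iii) $x_{1i}\le x_{2i}$ for all $i$ and $\vec{y_1}=\vec{y_2}$; (iv) $y_{1i}\ge y_{2i}$ for all $i$ and $\vec{x_1}=\vec{x_2}$. *)

theory Defs
  imports "HOL-Probability.Probability"
begin

section \<open>Majorization\<close>

definition largest_sum :: "nat \<Rightarrow> real list \<Rightarrow> real" where
  "largest_sum k xs = sum_list (take k (rev (sort xs)))"

definition majorized :: "real list \<Rightarrow> real list \<Rightarrow> bool" where
  "majorized xs ys \<longleftrightarrow>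
     length xs = length ys \<and>
     (\<forall>k\<in>{1..length xs}. largest_sum k xs \<le> largest_sum k ys) \<and>
     largest_sum (length xs) xs = largest_sum (length ys) ys"

section \<open>The reverse-coupled weakly sub-sup majorization order\<close>

text \<open>The coordinates \<open>1, \<dots>, n\<close> are the elements of a finite type \<open>'n\<close>.\<close>

type_synonym 'n vec_pair = "(real ^ 'n) \<times> (real ^ 'n)"

definition simul_perm :: "('n::finite vec_pair \<times> 'n vec_pair) set" where
  "simul_perm = {((x, y), (x', y')). \<exists>\<pi>. bij \<pi> \<and> (\<forall>i. x' $ i = x $ \<pi> i \<and> y' $ i = y $ \<pi> i)}"

lemma equiv_simul_perm: "equiv UNIV (simul_perm :: ('n::finite vec_pair \<times> 'n vec_pair) set)"
proof (rule equivI)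
  show "refl (simul_perm :: ('n vec_pair \<times> 'n vec_pair) set)"
    unfolding refl_on_def simul_perm_def by (auto intro!: exI[of _ id])
  show "sym (simul_perm :: ('n vec_pair \<times> 'n vec_pair) set)"
  proof (rule symI)
    fix a b :: "'n::finite vec_pair" assume "(a, b) \<in> simul_perm"
    then obtain x y x' y' \<pi> where ab: "a = (x, y)" "b = (x', y')" and \<pi>: "bij \<pi>"
      "\<And>i. x' $ i = x $ \<pi> i" "\<And>i. y' $ i = y $ \<pi> i"
      unfolding simul_perm_def by blast
    have "\<forall>i. x $ i = x' $ inv \<pi> i \<and> y $ i = y' $ inv \<pi> i"
      using \<pi> by (simp add: bij_is_surj surj_f_inv_f)
    then show "(b, a) \<in> simul_perm"
      unfolding simul_perm_def ab using bij_imp_bij_inv[OF \<pi>(1)] by blast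
  qed
  show "trans (simul_perm :: ('n vec_pair \<times> 'n vec_pair) set)"
  proof (rule transI)
    fix a b c :: "'n::finite vec_pair" assume "(a, b) \<in> simul_perm" "(b, c) \<in> simul_perm"
    then obtain x y x' y' x'' y'' \<pi> \<rho> where abc: "a = (x, y)" "b = (x', y')" "c = (x'', y'')"
      and \<pi>: "bij \<pi>" "\<And>i. x' $ i = x $ \<pi> i" "\<And>i. y' $ i = y $ \<pi> i"
      and \<rho>: "bij \<rho>" "\<And>i. x'' $ i = x' $ \<rho> i" "\<And>i. y'' $ i = y' $ \<rho> i"
      unfolding simul_perm_def by blast
    show "(a, c) \<in> simul_perm"
      unfolding simul_perm_def abc using bij_comp[OF \<rho>(1) \<pi>(1)]
      by (auto simp: \<pi> \<rho> intro!: exI[of _ "\<pi> \<circ> \<rho>"])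
  qed
qed simp

definition pair_classes :: "'n::finite vec_pair set set" where
  "pair_classes = UNIV // simul_perm"

definition pair_class :: "real ^ 'n::finite \<Rightarrow> real ^ 'n \<Rightarrow> 'n vec_pair set" where
  "pair_class x y = simul_perm `` {(x, y)}"

text \<open>
  In the first two rules \<open>i \<noteq> j\<close> stands for \<open>i < j\<close>: both conditions are symmetric in
  \<open>i\<close> and \<open>j\<close>, so only the unordered pair matters and no order on \<open>'n\<close> is needed.
\<close>

inductive rc_generator :: "'n::finite vec_pair \<Rightarrow> 'n vec_pair \<Rightarrow> bool" where
  fst_spread:
    "i \<noteq> j \<Longrightarrow> (y2 $ j - y2 $ i) * (x2 $ j - x2 $ i) \<le> 0 \<Longrightarrow>
     majorized [x1 $ i, x1 $ j] [x2 $ i, x2 $ j] \<Longrightarrow>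
     (\<forall>m. m \<noteq> i \<longrightarrow> m \<noteq> j \<longrightarrow> x1 $ m = x2 $ m) \<Longrightarrow> y1 = y2 \<Longrightarrow>
     rc_generator (x1, y1) (x2, y2)"
| snd_spread:
    "i \<noteq> j \<Longrightarrow> (y2 $ j - y2 $ i) * (x2 $ j - x2 $ i) \<le> 0 \<Longrightarrow>
     majorized [y1 $ i, y1 $ j] [y2 $ i, y2 $ j] \<Longrightarrow>
     (\<forall>m. m \<noteq> i \<longrightarrow> m \<noteq> j \<longrightarrow> y1 $ m = y2 $ m) \<Longrightarrow> x1 = x2 \<Longrightarrow>
     rc_generator (x1, y1) (x2, y2)"
| fst_increase:
    "(\<forall>i. x1 $ i \<le> x2 $ i) \<Longrightarrow> y1 = y2 \<Longrightarrow> rc_generator (x1, y1) (x2, y2)"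
| snd_decrease:
    "(\<forall>i. y1 $ i \<ge> y2 $ i) \<Longrightarrow> x1 = x2 \<Longrightarrow> rc_generator (x1, y1) (x2, y2)"

definition rc_step :: "'n::finite vec_pair set \<Rightarrow> 'n vec_pair set \<Rightarrow> bool" where
  "rc_step A B \<longleftrightarrow> A \<in> pair_classes \<and> B \<in> pair_classes \<and> (\<exists>a\<in>A. \<exists>b\<in>B. rc_generator a b)"

text \<open>
  The intermediate elements of a chain range over all of \<open>\<real>\<^sup>n \<times> \<real>\<^sup>n\<close> modulo permutation;
  they need not be admissible parameters of the distributions below.
\<close>

definition rc_majorized :: "'n::finite vec_pair set \<Rightarrow> 'n vec_pair set \<Rightarrow> bool" where
  "rc_majorized = rc_step\<^sup>*\<^sup>*"

definition vec_ln :: "real ^ 'n::finite \<Rightarrow> real ^ 'n" where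
  "vec_ln x = (\<chi> i. ln (x $ i))"

section \<open>Distributions and the stochastic order\<close>

definition negbin_prob :: "real \<Rightarrow> real \<Rightarrow> nat \<Rightarrow> real" where
  "negbin_prob \<alpha> p k = ((real k + \<alpha> - 1) gchoose k) * p powr \<alpha> * (1 - p) ^ k"

text \<open>
  Since \<open>0 powr a = 0\<close>, the value at \<open>t = 0\<close> is \<open>0\<close> for every \<open>\<alpha>\<close>, which may differ from
  the usual density only on this null set.
\<close>

definition gamma_density :: "real \<Rightarrow> real \<Rightarrow> real \<Rightarrow> real" where
  "gamma_density \<alpha> \<beta> t =
     (if t < 0 then 0 else \<beta> powr \<alpha> * t powr (\<alpha> - 1) / Gamma \<alpha> * exp (- \<beta> * t))"

definition indep_negbin ::
  "'a measure \<Rightarrow> ('n::finite \<Rightarrow> 'a \<Rightarrow> nat) \<Rightarrow> real ^ 'n \<Rightarrow> real ^ 'n \<Rightarrow> bool" where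
  "indep_negbin M X \<alpha> p \<longleftrightarrow>
     prob_space M \<and> prob_space.indep_vars M (\<lambda>_. count_space UNIV) X UNIV \<and>
     (\<forall>i k. measure M {\<omega> \<in> space M. X i \<omega> = k} = negbin_prob (\<alpha> $ i) (p $ i) k)"

definition indep_gamma ::
  "'a measure \<Rightarrow> ('n::finite \<Rightarrow> 'a \<Rightarrow> real) \<Rightarrow> real ^ 'n \<Rightarrow> real ^ 'n \<Rightarrow> bool" where
  "indep_gamma M Y \<alpha> \<beta> \<longleftrightarrow>
     prob_space M \<and> prob_space.indep_vars M (\<lambda>_. borel) Y UNIV \<and>
     (\<forall>i. distributed M lborel (Y i) (\<lambda>t. ennreal (gamma_density (\<alpha> $ i) (\<beta> $ i) t)))"

definition st_le :: "'a measure \<Rightarrow> ('a \<Rightarrow> real) \<Rightarrow> 'b measure \<Rightarrow> ('b \<Rightarrow> real) \<Rightarrow> bool" where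
  "st_le M1 Z1 M2 Z2 \<longleftrightarrow>
     (\<forall>t. measure M1 {\<omega> \<in> space M1. Z1 \<omega> \<ge> t} \<le> measure M2 {\<omega> \<in> space M2. Z2 \<omega> \<ge> t})"

end

theory Submission imports Defs begin

text \<open>
  Write \<open>D x y\<close> for the negative binomial law with \<open>p = exp y\<close>, or for the gamma law with
  \<open>\<beta> = exp y\<close>. For fixed \<open>y\<close> these laws form a convolution semigroup in \<open>x\<close>, and they decrease
  stochastically in \<open>y\<close>. Hence a step that spreads \<open>x\<close> only moves part of the shape from the larger
  to the smaller \<open>y\<close>. In a step that spreads \<open>y\<close>, split the law of larger shape into one of the
  smaller shape and a rest: the rest is handled by monotonicity in \<open>y\<close>, and what remains is a pair of
  laws of equal shape. That case is proved by a generating function computation for the negative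
  binomial law and by a reflection argument for the gamma law.
\<close>

section \<open>Stochastic order and convolution\<close>

text \<open>Logarithms are the right second coordinate because a spread of \<open>y\<close> keeps
  the sum \<open>y + y'\<close>, so the product of the two success probabilities or of the two rates
  stays fixed. For equal shapes the normalising factor of the pair is then constant, and only the
  way the two variables enter the sum changes.

  Reverse coupling puts the larger target shape at the smaller target \<open>y\<close>. It therefore
  fixes the direction in both reductions: shape that moves between the coordinates goes to the
  smaller \<open>y\<close>, and the rest split off from the larger shape also ends at the smaller
  \<open>y\<close>. Either move can only increase the law stochastically.

  Everything about chains is derived once from a few axioms on the family \<open>D\<close>, so the
  two families differ only in how these axioms are verified.\<close>

definition dist_le :: "real measure \<Rightarrow> real measure \<Rightarrow> bool" where
  "dist_le M N \<longleftrightarrow> (\<forall>t. measure M {t..} \<le> measure N {t..})"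

lemma dist_le_refl [simp]: "dist_le M M"
  by (simp add: dist_le_def)

lemma dist_le_trans [trans]: "dist_le M N \<Longrightarrow> dist_le N K \<Longrightarrow> dist_le M K"
  unfolding dist_le_def by (meson order_trans)

lemma real_distribution_convolution:
  assumes "real_distribution M" "real_distribution N"
  shows "real_distribution (M \<star> N)"
proof -
  interpret M: real_distribution M by fact
  interpret N: real_distribution N by fact
  interpret P: pair_prob_space M N ..
  have "prob_space (M \<star> N)"
    unfolding convolution_def by (rule P.prob_space_distr) simp
  then show ?thesis
    by (simp add: real_distribution_def real_distribution_axioms_def)
qed

lemma convolution_comm_real:
  assumes "real_distribution M" "real_distribution N"
  shows "(M \<star> N) = (N \<star> M)"
proof -
  interpret M: real_distribution M by fact
  interpret N: real_distribution N by fact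
  show ?thesis
    by (rule convolution_commutative) (simp_all add: M.finite_measure_axioms N.finite_measure_axioms)
qed

lemma convolution_assoc_real:
  assumes "real_distribution M" "real_distribution N" "real_distribution K"
  shows "((M \<star> N) \<star> K) = (M \<star> (N \<star> K))"
proof -
  interpret M: real_distribution M by fact
  interpret N: real_distribution N by fact
  interpret K: real_distribution K by fact
  show ?thesis
    by (rule convolution_associative[symmetric])
       (simp_all add: M.finite_measure_axioms N.finite_measure_axioms K.finite_measure_axioms)
qed

lemma emeasure_convolution_atLeast:
  assumes "real_distribution M" "real_distribution N"
  shows "emeasure (M \<star> N) {t..} = (\<integral>\<^sup>+x. emeasure N {t - x..} \<partial>M)"
proof -
  interpret M: real_distribution M by fact
  interpret N: real_distribution N by fact
  have "{a. a + x \<in> {t..}} = {t - x..}" for x :: real by auto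
  then show ?thesis
    by (subst convolution_emeasure)
       (simp_all add: M.finite_measure_axioms N.finite_measure_axioms)
qed

lemma dist_le_convolution_right:
  assumes K: "real_distribution K" and M: "real_distribution M" and N: "real_distribution N"
    and le: "dist_le M N"
  shows "dist_le (K \<star> M) (K \<star> N)"
  unfolding dist_le_def
proof
  fix t :: real
  interpret M: real_distribution M by fact
  interpret N: real_distribution N by fact
  interpret KM: real_distribution "K \<star> M" by (rule real_distribution_convolution[OF K M])
  interpret KN: real_distribution "K \<star> N" by (rule real_distribution_convolution[OF K N])
  have "emeasure (K \<star> M) {t..} \<le> emeasure (K \<star> N) {t..}"
    unfolding emeasure_convolution_atLeast[OF K M] emeasure_convolution_atLeast[OF K N]
    using le by (intro nn_integral_mono)
      (simp add: M.emeasure_eq_measure N.emeasure_eq_measure dist_le_def)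
  then show "measure (K \<star> M) {t..} \<le> measure (K \<star> N) {t..}"
    by (simp add: KM.emeasure_eq_measure KN.emeasure_eq_measure)
qed

lemma dist_le_convolution:
  assumes "real_distribution M" "real_distribution N" "real_distribution M'" "real_distribution N'"
    and "dist_le M M'" "dist_le N N'"
  shows "dist_le (M \<star> N) (M' \<star> N')"
proof -
  have "dist_le (M \<star> N) (M \<star> N')"
    using assms by (intro dist_le_convolution_right)
  also have "(M \<star> N') = (N' \<star> M)"
    using assms by (intro convolution_comm_real)
  also have "dist_le (N' \<star> M) (N' \<star> M')"
    using assms by (intro dist_le_convolution_right)
  also have "(N' \<star> M') = (M' \<star> N')"
    using assms by (intro convolution_comm_real)
  finally show ?thesis .
qed

lemma dist_le_convolution_nonneg:
  assumes M: "real_distribution M" and K: "real_distribution K" and K0: "measure K {0..} = 1"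
  shows "dist_le M (K \<star> M)"
  unfolding dist_le_def
proof
  fix t :: real
  interpret M: real_distribution M by fact
  interpret K: real_distribution K by fact
  interpret KM: real_distribution "K \<star> M" by (rule real_distribution_convolution[OF K M])
  have "AE x in K. x \<in> {0..}"
    using K0 by (simp add: K.prob_eq_1)
  then have *: "AE x in K. emeasure M {t..} \<le> emeasure M {t - x..}"
    by eventually_elim (auto intro!: emeasure_mono)
  have "emeasure M {t..} = (\<integral>\<^sup>+x. emeasure M {t..} \<partial>K)"
    using K.emeasure_space_1 by simp
  also have "\<dots> \<le> (\<integral>\<^sup>+x. emeasure M {t - x..} \<partial>K)"
    using * by (rule nn_integral_mono_AE)
  finally show "measure M {t..} \<le> measure (K \<star> M) {t..}"
    unfolding emeasure_convolution_atLeast[OF K M, symmetric]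
    by (simp add: KM.emeasure_eq_measure M.emeasure_eq_measure)
qed

section \<open>Laws of sums of independent variables\<close>

definition sum_law :: "'i set \<Rightarrow> ('i \<Rightarrow> real measure) \<Rightarrow> real measure" where
  "sum_law A D = distr (Pi\<^sub>M A D) borel (\<lambda>\<omega>. \<Sum>i\<in>A. \<omega> i)"

lemma sum_law_empty [simp]: "sum_law {} D = return borel 0"
proof -
  interpret P: prob_space "Pi\<^sub>M {} D" by (rule prob_space_PiM) simp
  show ?thesis unfolding sum_law_def by (simp add: P.distr_const)
qed

lemma (in prob_space) distr_sum_indep:
  assumes ind: "indep_vars (\<lambda>_. borel) X A"
  shows "distr M borel (\<lambda>\<omega>. \<Sum>i\<in>A. X i \<omega> :: real) = sum_law A (\<lambda>i. distr M borel (X i))"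
proof (cases "A = {}")
  case True
  then show ?thesis by (simp add: distr_const)
next
  case False
  have rv: "\<And>i. i \<in> A \<Longrightarrow> random_variable borel (X i)"
    using ind by (simp add: indep_vars_def)
  have "distr M (\<Pi>\<^sub>M i\<in>A. borel) (\<lambda>x. \<lambda>i\<in>A. X i x) = (\<Pi>\<^sub>M i\<in>A. distr M borel (X i))"
    using indep_vars_iff_distr_eq_PiM'[OF False rv] ind by simp
  then have "sum_law A (\<lambda>i. distr M borel (X i)) =
      distr (distr M (\<Pi>\<^sub>M i\<in>A. borel) (\<lambda>x. \<lambda>i\<in>A. X i x)) borel (\<lambda>\<omega>. \<Sum>i\<in>A. \<omega> i)"
    unfolding sum_law_def by simp
  also have "\<dots> = distr M borel (\<lambda>\<omega>. \<Sum>i\<in>A. X i \<omega>)"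
    using rv by (subst distr_distr) (auto simp: o_def)
  finally show ?thesis ..
qed

lemma sum_law_cong: "(\<And>i. i \<in> A \<Longrightarrow> D i = E i) \<Longrightarrow> sum_law A D = sum_law A E"
  unfolding sum_law_def by (metis PiM_cong)

lemma
  fixes D :: "'i \<Rightarrow> real measure"
  assumes D: "\<And>i. real_distribution (D i)" and A: "finite A"
  shows real_distribution_sum_law: "real_distribution (sum_law A D)"
    and sum_law_insert: "i \<notin> A \<Longrightarrow> sum_law (insert i A) D = (D i \<star> sum_law A D)"
proof -
  interpret D: real_distribution "D i" for i by (rule D)
  have *: "prob_space (Pi\<^sub>M B D)" for B
    by (rule prob_space_PiM) (rule D.prob_space_axioms)
  interpret P: prob_space "Pi\<^sub>M A D" by (rule *)
  show "real_distribution (sum_law A D)"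
    unfolding sum_law_def
    by (auto simp: real_distribution_def real_distribution_axioms_def intro!: P.prob_space_distr)
  assume i: "i \<notin> A"
  let ?B = "insert i A"
  interpret Q: prob_space "Pi\<^sub>M ?B D" by (rule *)
  have law: "distr (Pi\<^sub>M ?B D) borel (\<lambda>\<omega>. \<omega> j) = D j" if "j \<in> ?B" for j
  proof -
    have "distr (Pi\<^sub>M ?B D) (D j) (\<lambda>\<omega>. \<omega> j) = D j"
      using that A by (intro distr_PiM_component D.prob_space_axioms) auto
    then show ?thesis by (simp cong: distr_cong)
  qed
  \<comment> \<open>Independence of the coordinates is checked through their joint law: it is the
    product measure itself, hence the product of its marginals. The recursion then follows because
    independent summands have a convolution as the law of their sum.\<close>
  have ind: "Q.indep_vars (\<lambda>_. borel) (\<lambda>j \<omega>. \<omega> j) ?B"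
  proof (subst Q.indep_vars_iff_distr_eq_PiM')
    have "distr (Pi\<^sub>M ?B D) (Pi\<^sub>M ?B (\<lambda>_. borel)) (\<lambda>x. \<lambda>j\<in>?B. x j) = distr (Pi\<^sub>M ?B D) (Pi\<^sub>M ?B D) (\<lambda>x. x)"
      by (intro distr_cong sets_PiM_cong) (auto simp: space_PiM PiE_def restrict_def extensional_def fun_eq_iff)
    also have "\<dots> = Pi\<^sub>M ?B (\<lambda>j. distr (Pi\<^sub>M ?B D) borel (\<lambda>\<omega>. \<omega> j))"
      by (simp only: distr_id2) (rule PiM_cong, simp_all add: law)
    finally show "distr (Pi\<^sub>M ?B D) (Pi\<^sub>M ?B (\<lambda>_. borel)) (\<lambda>x. \<lambda>j\<in>?B. x j) =
      Pi\<^sub>M ?B (\<lambda>j. distr (Pi\<^sub>M ?B D) borel (\<lambda>\<omega>. \<omega> j))" .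
  qed auto
  have iv: "Q.indep_var borel (\<lambda>\<omega>. \<omega> i) borel (\<lambda>\<omega>. \<Sum>j\<in>A. \<omega> j)"
    by (rule Q.indep_vars_sum[OF A i ind])
  have "sum_law ?B D = distr (Pi\<^sub>M ?B D) borel (\<lambda>\<omega>. \<omega> i + (\<Sum>j\<in>A. \<omega> j))"
    unfolding sum_law_def using A i by simp
  also have "\<dots> = (distr (Pi\<^sub>M ?B D) borel (\<lambda>\<omega>. \<omega> i) \<star> distr (Pi\<^sub>M ?B D) borel (\<lambda>\<omega>. \<Sum>j\<in>A. \<omega> j))"
    using iv by (intro Q.sum_indep_random_variable) (auto simp: Q.indep_var_rv1 Q.indep_var_rv2)
  also have "distr (Pi\<^sub>M ?B D) borel (\<lambda>\<omega>. \<Sum>j\<in>A. \<omega> j) =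
      sum_law A (\<lambda>j. distr (Pi\<^sub>M ?B D) borel (\<lambda>\<omega>. \<omega> j))"
    using Q.indep_vars_subset[OF ind] by (intro Q.distr_sum_indep) auto
  also have "\<dots> = sum_law A D"
    by (rule sum_law_cong) (simp add: law)
  finally show "sum_law ?B D = (D i \<star> sum_law A D)"
    by (simp add: law)
qed

lemma dist_le_sum_law:
  assumes "finite A" and "\<And>i. real_distribution (D i)" "\<And>i. real_distribution (E i)"
    and "\<And>i. dist_le (D i) (E i)"
  shows "dist_le (sum_law A D) (sum_law A E)"
  using assms(1)
proof induction
  case empty
  show ?case by simp
next
  case (insert i A)
  then show ?case
    using assms
    by (simp add: sum_law_insert dist_le_convolution real_distribution_sum_law)
qed

lemma sum_law_reindex:
  assumes "finite A" "inj_on \<pi> A" and D: "\<And>i. real_distribution (D i)"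
  shows "sum_law (\<pi> ` A) D = sum_law A (\<lambda>i. D (\<pi> i))"
  using assms(1,2)
proof induction
  case empty
  show ?case by simp
next
  case (insert i A)
  then show ?case
    using D by (simp add: sum_law_insert)
qed

lemma sum_law_pair:
  fixes i j :: "'i :: finite"
  assumes "\<And>i. real_distribution (D i)" and "i \<noteq> j"
  shows "sum_law UNIV D = ((D i \<star> D j) \<star> sum_law (UNIV - {i, j}) D)"
proof -
  have "UNIV = insert i (insert j (UNIV - {i, j}))" by auto
  then have "sum_law UNIV D = sum_law (insert i (insert j (UNIV - {i, j}))) D" by simp
  also have "\<dots> = (D i \<star> (D j \<star> sum_law (UNIV - {i, j}) D))"
    using assms by (simp add: sum_law_insert)
  finally show ?thesis
    using assms by (simp add: convolution_assoc_real real_distribution_sum_law)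
qed

text \<open>All coordinates other than \<open>i\<close> and \<open>j\<close> form a common
  convolution factor, so a spread is a question about two laws only.\<close>

lemma dist_le_sum_law_pair:
  fixes i j :: "'i :: finite"
  assumes D: "\<And>i. real_distribution (D i)" and E: "\<And>i. real_distribution (E i)" and ij: "i \<noteq> j"
    and eq: "\<And>m. m \<noteq> i \<Longrightarrow> m \<noteq> j \<Longrightarrow> D m = E m" and le: "dist_le (D i \<star> D j) (E i \<star> E j)"
  shows "dist_le (sum_law UNIV D) (sum_law UNIV E)"
proof -
  have "sum_law (UNIV - {i, j}) D = sum_law (UNIV - {i, j}) E"
    using eq by (intro sum_law_cong) auto
  then show ?thesis
    unfolding sum_law_pair[OF D ij] sum_law_pair[OF E ij]
    using le D E by (simp add: dist_le_convolution real_distribution_convolution real_distribution_sum_law)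
qed

section \<open>Families compatible with the majorization order\<close>

lemma majorized_pair_iff:
  "majorized [a, b] [c, d] \<longleftrightarrow> max a b \<le> max c d \<and> a + b = c + d"
  unfolding majorized_def largest_sum_def
  by (auto simp: numeral_2_eq_2 atLeastAtMostSuc_conv max_def)

text \<open>Negative binomial laws require \<open>y < 0\<close>. The admissible set is cut down to a
  closed half-line \<open>y \<le> c\<close>, so that \<open>min y c\<close> always lies in it. In
  \<open>spread\<close> the shapes are equal, and \<open>2 * s \<le> y' - y\<close> says that the
  two parameters approach each other without crossing.\<close>

locale rc_family =
  fixes D :: "real \<Rightarrow> real \<Rightarrow> real measure" and c :: real
  assumes real_distribution: "0 < x \<Longrightarrow> y \<le> c \<Longrightarrow> real_distribution (D x y)"
    and nonneg: "0 < x \<Longrightarrow> y \<le> c \<Longrightarrow> measure (D x y) {0..} = 1"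
    and semigroup: "0 < a \<Longrightarrow> 0 < b \<Longrightarrow> y \<le> c \<Longrightarrow> (D a y \<star> D b y) = D (a + b) y"
    and antimono: "0 < x \<Longrightarrow> y \<le> y' \<Longrightarrow> y' \<le> c \<Longrightarrow> dist_le (D x y') (D x y)"
    and spread: "0 < x \<Longrightarrow> y \<le> y' \<Longrightarrow> y' \<le> c \<Longrightarrow> 0 \<le> s \<Longrightarrow> 2 * s \<le> y' - y \<Longrightarrow>
      dist_le (D x (y + s) \<star> D x (y' - s)) (D x y \<star> D x y')"
begin

text \<open>Enlarging the shape from \<open>a\<close> to \<open>b\<close> adds an independent
  nonnegative variable of shape \<open>b - a\<close>.\<close>

lemma mono:
  assumes "0 < a" "a \<le> b" "y \<le> c"
  shows "dist_le (D a y) (D b y)"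
proof (cases "a = b")
  case False
  then have "dist_le (D a y) (D (b - a) y \<star> D a y)"
    using assms by (intro dist_le_convolution_nonneg real_distribution nonneg) auto
  also have "(D (b - a) y \<star> D a y) = D b y"
    using assms False by (simp add: semigroup)
  finally show ?thesis .
qed simp

text \<open>The inequalities on the shapes are the weak majorization that is left after truncation.
  If \<open>b\<close> exceeds \<open>v\<close>, the surplus \<open>b - v\<close> is moved from
  \<open>y'\<close> to the smaller parameter \<open>y\<close>, and then enlarged to
  \<open>u - a\<close>, which is at least \<open>b - v\<close> because of the inequality between the
  sums.\<close>

lemma fst_pair:
  assumes pos: "0 < a" "0 < b" "0 < v" and le: "a \<le> u" "a + b \<le> u + v" and y: "y \<le> y'" "y' \<le> c"
  shows "dist_le (D a y \<star> D b y') (D u y \<star> D v y')"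
proof (cases "b \<le> v")
  case True
  then show ?thesis
    using assms by (intro dist_le_convolution real_distribution mono) auto
next
  case False
  then have [simp]: "v < b" "a < u" using le by auto
  have [simp]: "y \<le> c" using y by simp
  note rd = real_distribution real_distribution_convolution
  have "dist_le (D (b - v) y') (D (b - v) y)"
    using y by (intro antimono) auto
  also have "dist_le (D (b - v) y) (D (u - a) y)"
    using le by (intro mono) auto
  finally have *: "dist_le (D (b - v) y') (D (u - a) y)" .
  have "(D a y \<star> D b y') = (D a y \<star> (D (b - v) y' \<star> D v y'))"
    using pos y by (simp add: semigroup)
  also have "dist_le \<dots> (D a y \<star> (D (u - a) y \<star> D v y'))"
    using * pos y by (intro dist_le_convolution rd) auto
  also have "\<dots> = (D u y \<star> D v y')"
    using pos y by (simp add: semigroup convolution_assoc_real[symmetric] real_distribution)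
  finally show ?thesis .
qed

text \<open>Beyond the midpoint the two parameters have changed places. Reflecting \<open>s\<close>
  to \<open>y' - y - s\<close> and using commutativity reduces to the case before the
  midpoint.\<close>

lemma spread':
  assumes "0 < x" "y \<le> y'" "y' \<le> c" "0 \<le> s" "s \<le> y' - y"
  shows "dist_le (D x (y + s) \<star> D x (y' - s)) (D x y \<star> D x y')"
proof (cases "2 * s \<le> y' - y")
  case True
  then show ?thesis using assms by (intro spread)
next
  case False
  have "(D x (y + s) \<star> D x (y' - s)) = (D x (y' - s) \<star> D x (y + s))"
    using assms by (intro convolution_comm_real real_distribution) auto
  also have "dist_le \<dots> (D x y \<star> D x y')"
    using spread[of x y y' "y' - y - s"] assms False by simp
  finally show ?thesis .
qed

lemma snd_pair_equal_shape:
  assumes x: "0 < x" and le: "u \<le> a" "u \<le> b" "u + v \<le> a + b" "u \<le> v" and c: "a \<le> c" "b \<le> c" "v \<le> c"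
  shows "dist_le (D x a \<star> D x b) (D x u \<star> D x v)"
proof (cases "v \<le> b")
  case True
  then show ?thesis
    using assms by (intro dist_le_convolution real_distribution antimono) auto
next
  case False
  \<comment> \<open>Lowering \<open>a\<close> to \<open>u + v - b\<close> restores the sum
    \<open>u + v\<close>. What is then left is a genuine spread, with step \<open>v - b\<close>; it
    is at most \<open>v - u\<close> because \<open>u \<le> b\<close>.\<close>
  have "dist_le (D x a \<star> D x b) (D x (u + v - b) \<star> D x b)"
    using assms False by (intro dist_le_convolution real_distribution antimono) auto
  also have "dist_le \<dots> (D x u \<star> D x v)"
    using spread'[of x u v "v - b"] assms False by (simp add: algebra_simps)
  finally show ?thesis .
qed

text \<open>The rest has shape \<open>x - x'\<close> and sits at \<open>a\<close>. Since the larger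
  shape \<open>x\<close> ends at the smaller parameter \<open>u \<le> a\<close>, the rest moves in
  the favourable direction; this is where reverse coupling enters.\<close>

lemma snd_pair:
  assumes x: "0 < x'" "x' \<le> x" and le: "u \<le> a" "u \<le> b" "u + v \<le> a + b" "u \<le> v"
    and c: "a \<le> c" "b \<le> c" "v \<le> c"
  shows "dist_le (D x a \<star> D x' b) (D x u \<star> D x' v)"
proof (cases "x = x'")
  case True
  then show ?thesis using snd_pair_equal_shape assms by simp
next
  case False
  then have [simp]: "x' < x" "0 < x" "u \<le> c" using assms by auto
  note rd = real_distribution real_distribution_convolution
  have "(D x a \<star> D x' b) = (D (x - x') a \<star> (D x' a \<star> D x' b))"
    using x c by (simp add: convolution_assoc_real[symmetric] real_distribution semigroup)
  also have "dist_le \<dots> (D (x - x') u \<star> (D x' u \<star> D x' v))"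
    using assms by (intro dist_le_convolution rd antimono snd_pair_equal_shape) auto
  also have "\<dots> = (D x u \<star> D x' v)"
    using x c by (simp add: convolution_assoc_real[symmetric] real_distribution semigroup)
  finally show ?thesis .
qed

end

text \<open>Chains may leave the admissible parameters; truncation brings them back, and is harmless
  because it turns the majorizations of rules (i) and (ii) into weak majorizations in the
  favourable direction.\<close>

locale truncated_rc_family = rc_family +
  fixes \<epsilon> :: real
  assumes eps: "0 < \<epsilon>"
begin

definition trunc_law :: "'n::finite vec_pair \<Rightarrow> real measure" where
  "trunc_law a = sum_law UNIV (\<lambda>i. D (max (fst a $ i) \<epsilon>) (min (snd a $ i) c))"

lemma real_distribution_trunc [simp]: "real_distribution (D (max x \<epsilon>) (min y c))"
  using eps by (intro real_distribution) auto

lemma trunc_law_perm: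
  assumes "(a, b) \<in> simul_perm"
  shows "trunc_law a = trunc_law b"
proof -
  obtain x y x' y' \<pi> where ab: "a = (x, y)" "b = (x', y')" and \<pi>: "bij \<pi>"
    "\<And>i. x' $ i = x $ \<pi> i" "\<And>i. y' $ i = y $ \<pi> i"
    using assms unfolding simul_perm_def by blast
  have "trunc_law a = sum_law (range \<pi>) (\<lambda>i. D (max (x $ i) \<epsilon>) (min (y $ i) c))"
    using \<pi>(1) by (simp add: trunc_law_def ab bij_is_surj)
  also have "\<dots> = trunc_law b"
    using \<pi> by (subst sum_law_reindex) (simp_all add: trunc_law_def ab bij_is_inj)
  finally show ?thesis .
qed

text \<open>The map \<open>max _ \<epsilon>\<close> is increasing and convex, so it preserves the
  upper bounds on the largest entry and on the sum in rule (i). The map \<open>min _ c\<close> is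
  increasing and concave, so it preserves the lower bounds on the smallest entry and on the sum in
  rule (ii). These are the hypotheses of \<open>fst_pair\<close> and
  \<open>snd_pair\<close>.\<close>

lemma trunc_law_generator:
  assumes "rc_generator a b"
  shows "dist_le (trunc_law a) (trunc_law b)"
proof -
  have *: "dist_le (sum_law UNIV (\<lambda>m. D (max (x1 $ m) \<epsilon>) (min (y $ m) c)))
      (sum_law UNIV (\<lambda>m. D (max (x2 $ m) \<epsilon>) (min (y $ m) c)))"
    if "i \<noteq> j" "y $ i \<le> y $ j" "x2 $ j \<le> x2 $ i" "majorized [x1 $ i, x1 $ j] [x2 $ i, x2 $ j]"
      "\<forall>m. m \<noteq> i \<longrightarrow> m \<noteq> j \<longrightarrow> x1 $ m = x2 $ m" for x1 x2 y :: "real ^ 'b::finite" and i j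
    using that eps
    by (intro dist_le_sum_law_pair[of _ _ i j] fst_pair) (auto simp: majorized_pair_iff)
  have **: "dist_le (sum_law UNIV (\<lambda>m. D (max (x $ m) \<epsilon>) (min (y1 $ m) c)))
      (sum_law UNIV (\<lambda>m. D (max (x $ m) \<epsilon>) (min (y2 $ m) c)))"
    if "i \<noteq> j" "y2 $ i \<le> y2 $ j" "x $ j \<le> x $ i" "majorized [y1 $ i, y1 $ j] [y2 $ i, y2 $ j]"
      "\<forall>m. m \<noteq> i \<longrightarrow> m \<noteq> j \<longrightarrow> y1 $ m = y2 $ m" for x y1 y2 :: "real ^ 'b::finite" and i j
    using that eps
    by (intro dist_le_sum_law_pair[of _ _ i j] snd_pair) (auto simp: majorized_pair_iff)
  \<comment> \<open>The facts above let \<open>i\<close> carry the larger shape and the smaller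
    second coordinate. The sign condition of the rules allows either index in that role, and
    exchanging the indices covers the other case.\<close>
  have swap: "majorized [r, s] [t, u] \<Longrightarrow> majorized [s, r] [u, t]" for r s t u
    by (auto simp: majorized_pair_iff)
  show ?thesis
    using assms
  proof cases
    case (fst_spread i j y2 x2 x1 y1)
    then consider "x2 $ j \<le> x2 $ i" "y2 $ i \<le> y2 $ j" | "x2 $ i \<le> x2 $ j" "y2 $ j \<le> y2 $ i"
      by (auto simp: mult_le_0_iff)
    then show ?thesis
      using fst_spread *[of i j y2 x2 x1] *[of j i y2 x2 x1] swap
      by cases (auto simp: trunc_law_def)
  next
    case (snd_spread i j y2 x2 y1 x1)
    then consider "x2 $ j \<le> x2 $ i" "y2 $ i \<le> y2 $ j" | "x2 $ i \<le> x2 $ j" "y2 $ j \<le> y2 $ i"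
      by (auto simp: mult_le_0_iff)
    then show ?thesis
      using snd_spread **[of i j y2 x2 y1] **[of j i y2 x2 y1] swap
      by cases (auto simp: trunc_law_def)
  next
    case (fst_increase x1 x2 y1 y2)
    have "max (x1 $ i) \<epsilon> \<le> max (x2 $ i) \<epsilon>" for i
      using fst_increase by (meson max.mono order_refl)
    then show ?thesis
      unfolding trunc_law_def using fst_increase eps by (auto intro!: dist_le_sum_law mono)
  next
    case (snd_decrease y1 y2 x1 x2)
    have "min (y2 $ i) c \<le> min (y1 $ i) c" for i
      using snd_decrease by (meson min.mono order_refl)
    then show ?thesis
      unfolding trunc_law_def using snd_decrease eps by (auto intro!: dist_le_sum_law antimono)
  qed
qed

lemma trunc_law_rc_majorized:
  fixes x1 y1 x2 y2 :: "real ^ 'n::finite"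
  assumes "rc_majorized (pair_class x1 y1) (pair_class x2 y2)"
  shows "dist_le (trunc_law (x1, y1)) (trunc_law (x2, y2))"
proof -
  have class_eq: "trunc_law a = trunc_law b"
    if A: "A \<in> pair_classes" and ab: "a \<in> A" "b \<in> A" for A and a b :: "'n vec_pair"
  proof (rule trunc_law_perm)
    show "(a, b) \<in> simul_perm"
      using that quotient_eqI[OF equiv_simul_perm] unfolding pair_classes_def
      by (metis equiv_simul_perm quotient_eq_iff)
  qed
  \<comment> \<open>The claim is made for all representatives of \<open>B\<close>, since the next
    step of the chain may start from a different one than the previous step produced.\<close>
  have "\<forall>b\<in>B. dist_le (trunc_law (x1, y1)) (trunc_law b)" if "rc_step\<^sup>*\<^sup>* (pair_class x1 y1) B" for B
    using that
  proof induction
    case base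
    then show ?case
      by (auto simp: pair_class_def dest: trunc_law_perm)
  next
    case (step A B)
    then obtain a b where ab: "a \<in> A" "b \<in> B" "rc_generator a b" "B \<in> pair_classes"
      by (auto simp: rc_step_def)
    have "dist_le (trunc_law (x1, y1)) (trunc_law b)"
      using step.IH ab trunc_law_generator dist_le_trans by blast
    then show ?case
      using class_eq ab by metis
  qed
  moreover have "(x2, y2) \<in> pair_class x2 y2"
    unfolding pair_class_def using equiv_class_self[OF equiv_simul_perm] by blast
  ultimately show ?thesis
    using assms unfolding rc_majorized_def by blast
qed

lemma dist_le_sum_law_rc_majorized:
  fixes x1 y1 x2 y2 :: "real ^ 'n::finite"
  assumes "rc_majorized (pair_class x1 y1) (pair_class x2 y2)"
    and "\<And>i. \<epsilon> \<le> x1 $ i" "\<And>i. \<epsilon> \<le> x2 $ i" "\<And>i. y1 $ i \<le> c" "\<And>i. y2 $ i \<le> c"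
  shows "dist_le (sum_law UNIV (\<lambda>i. D (x1 $ i) (y1 $ i))) (sum_law UNIV (\<lambda>i. D (x2 $ i) (y2 $ i)))"
  using trunc_law_rc_majorized[OF assms(1)] assms(2-)
  by (simp add: trunc_law_def max_absorb1 min_absorb1)

end

section \<open>Negative binomial laws\<close>

text \<open>This is the coefficient of \<open>q ^ k\<close> in the binomial series of
  \<open>(1 - q) powr (- a)\<close>. In this form recurrences in the shape become recurrences of
  Pochhammer symbols.\<close>

definition negbin_coeff :: "real \<Rightarrow> nat \<Rightarrow> real" where
  "negbin_coeff a k = pochhammer a k / fact k"

lemma gbinomial_negbin_coeff: "((real k + a - 1) gchoose k) = negbin_coeff a k"
  by (simp add: gbinomial_pochhammer' negbin_coeff_def)

lemma gbinomial_uminus_negbin_coeff: "((- a) gchoose k) = (- 1) ^ k * negbin_coeff a k"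
  by (simp add: gbinomial_pochhammer negbin_coeff_def)

lemma negbin_coeff_0 [simp]: "negbin_coeff a 0 = 1"
  by (simp add: negbin_coeff_def)

lemma negbin_coeff_pos: "0 < a \<Longrightarrow> 0 < negbin_coeff a k"
  by (simp add: negbin_coeff_def pochhammer_pos)

lemma Suc_negbin_coeff: "real (Suc k) * negbin_coeff a (Suc k) = a * negbin_coeff (a + 1) k"
  by (simp add: negbin_coeff_def pochhammer_rec field_simps del: of_nat_Suc)

text \<open>Pascal's rule: it compares coefficients in
  \<open>(1 - X) (1 - X)^(-a-1) = (1 - X)^(-a)\<close>.\<close>

lemma negbin_coeff_Suc_shape:
  "negbin_coeff (a + 1) (Suc k) = negbin_coeff a (Suc k) + negbin_coeff (a + 1) k"
proof -
  have "pochhammer (a + 1) (Suc k) = pochhammer (a + 1) k * (a + 1 + real k)"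
    by (simp add: pochhammer_Suc)
  moreover have "pochhammer a (Suc k) = a * pochhammer (a + 1) k"
    by (rule pochhammer_rec)
  moreover have "pochhammer (a + 1) k / fact k = (1 + real k) * pochhammer (a + 1) k / fact (Suc k)"
    by (simp add: fact_Suc)
  ultimately show ?thesis
    unfolding negbin_coeff_def by (simp only: add_divide_distrib[symmetric]) (simp add: algebra_simps)
qed

lemma negbin_coeff_sums:
  assumes "\<bar>q\<bar> < 1"
  shows "(\<lambda>k. negbin_coeff a k * q ^ k) sums (1 - q) powr (- a)"
proof -
  have "((- a) gchoose k) * (- q) ^ k = negbin_coeff a k * q ^ k" for k
    unfolding gbinomial_uminus_negbin_coeff by (subst power_minus) simp
  then show ?thesis
    using gen_binomial_real[of "- q" "- a"] assms by simp
qed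

text \<open>Vandermonde's identity with upper entries \<open>- a\<close> and \<open>- b\<close>; the
  signs combine to the common factor \<open>(- 1) ^ m\<close>.\<close>

lemma negbin_coeff_convolution:
  "(\<Sum>i\<le>m. negbin_coeff a i * negbin_coeff b (m - i)) = negbin_coeff (a + b) m"
proof -
  have "(- 1) ^ m * negbin_coeff (a + b) m = (\<Sum>i\<le>m. ((- a) gchoose i) * ((- b) gchoose (m - i)))"
    using gbinomial_Vandermonde[of "- a" "- b" m] gbinomial_uminus_negbin_coeff[of "a + b" m]
    by (simp add: atLeast0AtMost)
  also have "\<dots> = (\<Sum>i\<le>m. (- 1) ^ m * (negbin_coeff a i * negbin_coeff b (m - i)))"
  proof (intro sum.cong refl)
    fix i assume "i \<in> {..m}"
    then have "(- 1) ^ m = (- 1) ^ i * (- 1 :: real) ^ (m - i)"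
      by (simp flip: power_add)
    then show "((- a) gchoose i) * ((- b) gchoose (m - i)) =
        (- 1) ^ m * (negbin_coeff a i * negbin_coeff b (m - i))"
      by (simp only: gbinomial_uminus_negbin_coeff mult_ac)
  qed
  finally show ?thesis by (simp flip: sum_distrib_left)
qed

section \<open>Negative binomial probabilities and their distribution function\<close>

lemma negbin_prob_exp:
  "negbin_prob a (exp y) k = exp (a * y) * (negbin_coeff a k * (1 - exp y) ^ k)"
  by (simp add: negbin_prob_def gbinomial_negbin_coeff powr_def mult_ac)

lemma negbin_prob_nonneg: "0 < a \<Longrightarrow> y \<le> 0 \<Longrightarrow> 0 \<le> negbin_prob a (exp y) k"
  by (simp add: negbin_prob_exp negbin_coeff_pos less_imp_le)

lemma negbin_prob_sums:
  assumes "y < 0"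
  shows "negbin_prob a (exp y) sums 1"
proof -
  have "(\<lambda>k. negbin_coeff a k * (1 - exp y) ^ k) sums (exp y powr (- a))"
    using negbin_coeff_sums[of "1 - exp y" a] assms by simp
  from sums_mult[OF this, of "exp (a * y)"] show ?thesis
    unfolding negbin_prob_exp[abs_def] by (simp add: powr_def flip: exp_add)
qed

lemma negbin_prob_convolution:
  "(\<Sum>i\<le>m. negbin_prob a (exp y) i * negbin_prob b (exp y) (m - i)) = negbin_prob (a + b) (exp y) m"
proof -
  have "(\<Sum>i\<le>m. negbin_prob a (exp y) i * negbin_prob b (exp y) (m - i)) =
     (\<Sum>i\<le>m. exp ((a + b) * y) * (1 - exp y) ^ m * (negbin_coeff a i * negbin_coeff b (m - i)))"
  proof (intro sum.cong refl)
    fix i assume "i \<in> {..m}"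
    then have "(1 - exp y) ^ m = (1 - exp y) ^ i * (1 - exp y) ^ (m - i)"
      by (simp flip: power_add)
    then show "negbin_prob a (exp y) i * negbin_prob b (exp y) (m - i) =
        exp ((a + b) * y) * (1 - exp y) ^ m * (negbin_coeff a i * negbin_coeff b (m - i))"
      by (simp add: negbin_prob_exp distrib_right exp_add)
  qed
  then show ?thesis
    by (simp add: negbin_prob_exp negbin_coeff_convolution flip: sum_distrib_left)
qed

text \<open>With \<open>p = exp y\<close> and \<open>q = 1 - p\<close>, the generating function
  \<open>(p / (1 - q w))^a\<close> has logarithmic derivative \<open>a (1 - w) / (1 - q w)\<close>
  in \<open>y\<close>. Partial summation removes the factor \<open>1 - w\<close>, so the derivative
  of the distribution function at \<open>m\<close> is a single nonnegative coefficient of shape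
  \<open>a + 1\<close>. The induction on \<open>m\<close> verifies this formula.\<close>

lemma negbin_cdf_mono:
  assumes a: "0 < a" and y: "y \<le> y'" "y' \<le> 0"
  shows "(\<Sum>k\<le>m. negbin_prob a (exp y) k) \<le> (\<Sum>k\<le>m. negbin_prob a (exp y') k)"
proof (rule DERIV_nonneg_imp_nondecreasing[OF y(1)])
  have deriv: "((\<lambda>z. \<Sum>k\<le>m. negbin_prob a (exp z) k) has_real_derivative
      a * exp (a * z) * (negbin_coeff (a + 1) m * (1 - exp z) ^ m)) (at z)" for z
  proof (induction m)
    case 0
    show ?case by (auto simp: negbin_prob_exp intro!: derivative_eq_intros)
  next
    case (Suc m)
    have base: "((\<lambda>z. 1 - exp z) has_real_derivative - exp z) (at z)"
      by (auto intro!: derivative_eq_intros)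
    have "((\<lambda>z. (1 - exp z) ^ Suc m) has_real_derivative real (Suc m) * (- exp z * (1 - exp z) ^ m)) (at z)"
      using DERIV_power[OF base, of "Suc m"] by simp
    moreover have "((\<lambda>z. exp (a * z)) has_real_derivative exp (a * z) * a) (at z)"
      by (auto intro!: derivative_eq_intros)
    ultimately have "((\<lambda>z. exp (a * z) * (negbin_coeff a (Suc m) * (1 - exp z) ^ Suc m)) has_real_derivative
        exp (a * z) * a * (negbin_coeff a (Suc m) * (1 - exp z) ^ Suc m) +
        negbin_coeff a (Suc m) * (real (Suc m) * (- exp z * (1 - exp z) ^ m)) * exp (a * z)) (at z)"
      by (intro DERIV_mult DERIV_cmult)
    then have "((\<lambda>z. \<Sum>k\<le>Suc m. negbin_prob a (exp z) k) has_real_derivative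
        a * exp (a * z) * (negbin_coeff (a + 1) m * (1 - exp z) ^ m)
        + (a * exp (a * z) * (negbin_coeff a (Suc m) * (1 - exp z) ^ Suc m)
        - exp (a * z) * ((real (Suc m) * negbin_coeff a (Suc m)) * exp z * (1 - exp z) ^ m))) (at z)"
      unfolding sum.atMost_Suc negbin_prob_exp[of _ _ "Suc m"]
      by (intro DERIV_add[OF Suc], elim DERIV_cong) (simp add: mult_ac del: of_nat_Suc power_Suc)
    then show ?case
      unfolding Suc_negbin_coeff negbin_coeff_Suc_shape by (simp add: algebra_simps)
  qed
  fix z assume "y \<le> z" "z \<le> y'"
  then show "\<exists>d. ((\<lambda>z. \<Sum>k\<le>m. negbin_prob a (exp z) k) has_real_derivative d) (at z) \<and> 0 \<le> d"
    using deriv a y negbin_coeff_pos[of "a + 1" m]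
    by (intro exI[of _ "a * exp (a * z) * (negbin_coeff (a + 1) m * (1 - exp z) ^ m)"]) auto
qed

text \<open>The formal power series \<open>(1 - q X)^(-a)\<close>, that is, the probability
  generating function without its factor \<open>p^a\<close>.\<close>

definition negbin_fps :: "real \<Rightarrow> real \<Rightarrow> real fps" where
  "negbin_fps a q = Abs_fps (\<lambda>k. negbin_coeff a k * q ^ k)"

lemma negbin_fps_Suc_shape: "(1 - fps_const q * fps_X) * negbin_fps (a + 1) q = negbin_fps a q"
proof (rule fps_ext)
  fix k
  show "fps_nth ((1 - fps_const q * fps_X) * negbin_fps (a + 1) q) k = fps_nth (negbin_fps a q) k"
    by (cases k) (simp_all add: negbin_fps_def algebra_simps
        negbin_coeff_Suc_shape[of a, unfolded add.commute[of a 1]])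
qed

text \<open>The series on the left is the derivative of \<open>(1 - q X)^(-a)\<close> with respect
  to \<open>q\<close>. At \<open>k = 0\<close> the truncated exponent \<open>k - 1\<close> is
  harmless because of the factor \<open>real k\<close>.\<close>

lemma negbin_fps_deriv_nth:
  "fps_nth (fps_const a * fps_X * negbin_fps (a + 1) q) k = real k * negbin_coeff a k * q ^ (k - 1)"
  by (cases k) (simp_all add: negbin_fps_def mult.assoc Suc_negbin_coeff del: of_nat_Suc)

lemma sum_fps_nth_one_minus_X:
  fixes H :: "'a::comm_ring_1 fps"
  shows "(\<Sum>k\<le>m. fps_nth ((1 - fps_X) * H) k) = fps_nth H m"
proof (induction m)
  case (Suc m)
  then show ?case by (simp add: left_diff_distrib)
qed (simp add: left_diff_distrib)

text \<open>The probability generating function of the sum is a power of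
  \<open>p1 p2 / ((1 - q1 z) (1 - q2 z))\<close>. Moving the success probabilities with
  \<open>p1 p2\<close> fixed, the derivative of the generating function acquires a factor \<open>1 - z\<close>,
  which cancels on passing to the distribution function.\<close>

lemma negbin_pair_cdf_mono:
  assumes a: "0 < a" and y: "y \<le> y'" "y' < 0" and s: "0 \<le> s" "2 * s \<le> y' - y"
  shows "(\<Sum>k\<le>m. \<Sum>i\<le>k. negbin_prob a (exp y) i * negbin_prob a (exp y') (k - i))
    \<le> (\<Sum>k\<le>m. \<Sum>i\<le>k. negbin_prob a (exp (y + s)) i * negbin_prob a (exp (y' - s)) (k - i))"
proof -
  define p1 p2 q1 q2 where "p1 z = exp (y + z)" and "p2 z = exp (y' - z)"
    and "q1 z = 1 - p1 z" and "q2 z = 1 - p2 z" for z :: real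
  define F where "F z = (\<Sum>k\<le>m. \<Sum>i\<le>k. negbin_prob a (p1 z) i * negbin_prob a (p2 z) (k - i))" for z
  define H where "H z = negbin_fps (a + 1) (q1 z) * negbin_fps (a + 1) (q2 z)" for z
  define E where "E = exp (a * (y + y'))"
  have E_eq: "exp (a * (y + z)) * exp (a * (y' - z)) = E" for z
    unfolding E_def exp_add[symmetric] by (simp add: algebra_simps)
  have prod_eq: "negbin_prob a (p1 z) i * negbin_prob a (p2 z) j =
      E * ((negbin_coeff a i * q1 z ^ i) * (negbin_coeff a j * q2 z ^ j))" for z i j
    unfolding p1_def p2_def negbin_prob_exp q1_def q2_def E_eq[of z, symmetric]
    by (simp only: mult_ac)
  have F_eq: "F = (\<lambda>z. E * (\<Sum>k\<le>m. \<Sum>i\<le>k. (negbin_coeff a i * q1 z ^ i) *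
      (negbin_coeff a (k - i) * q2 z ^ (k - i))))"
    unfolding F_def prod_eq by (simp only: sum_distrib_left)
  have q1: "(q1 has_real_derivative - p1 z) (at z)" for z
    unfolding q1_def p1_def by (auto intro!: derivative_eq_intros)
  have q2: "(q2 has_real_derivative p2 z) (at z)" for z
    unfolding q2_def p2_def by (auto intro!: derivative_eq_intros)
  have deriv: "(F has_real_derivative E * (a * (p2 z - p1 z) * fps_nth (fps_X * H z) m)) (at z)" for z
  proof -
    let ?A = "negbin_fps a (q1 z)" and ?B = "negbin_fps a (q2 z)"
    let ?A' = "fps_const a * fps_X * negbin_fps (a + 1) (q1 z)"
    let ?B' = "fps_const a * fps_X * negbin_fps (a + 1) (q2 z)"
    let ?d = "\<lambda>k i. - p1 z * (fps_nth ?A' i * fps_nth ?B (k - i)) + p2 z * (fps_nth ?A i * fps_nth ?B' (k - i))"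
    have summand: "((\<lambda>z. (negbin_coeff a i * q1 z ^ i) * (negbin_coeff a (k - i) * q2 z ^ (k - i)))
        has_real_derivative ?d k i) (at z)" for k i
    proof (rule DERIV_cong)
      show "((\<lambda>z. (negbin_coeff a i * q1 z ^ i) * (negbin_coeff a (k - i) * q2 z ^ (k - i)))
        has_real_derivative
          (negbin_coeff a i * (real i * (- p1 z * q1 z ^ (i - Suc 0)))) * (negbin_coeff a (k - i) * q2 z ^ (k - i))
          + (negbin_coeff a (k - i) * (real (k - i) * (p2 z * q2 z ^ (k - i - Suc 0)))) * (negbin_coeff a i * q1 z ^ i)) (at z)"
        by (intro DERIV_mult DERIV_cmult DERIV_power q1 q2)
      show "(negbin_coeff a i * (real i * (- p1 z * q1 z ^ (i - Suc 0)))) * (negbin_coeff a (k - i) * q2 z ^ (k - i))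
          + (negbin_coeff a (k - i) * (real (k - i) * (p2 z * q2 z ^ (k - i - Suc 0)))) * (negbin_coeff a i * q1 z ^ i)
        = ?d k i"
        unfolding negbin_fps_deriv_nth by (simp add: negbin_fps_def)
    qed
    have "(F has_real_derivative E * (\<Sum>k\<le>m. \<Sum>i\<le>k. ?d k i)) (at z)"
      unfolding F_eq by (intro DERIV_cmult DERIV_sum summand)
    moreover have "(\<Sum>i\<le>k. ?d k i) =
        fps_nth (fps_const (- p1 z) * (?A' * ?B) + fps_const (p2 z) * (?A * ?B')) k" for k
      unfolding fps_add_nth fps_mult_left_const_nth fps_mult_nth[of ?A' ?B] fps_mult_nth[of ?A ?B']
      by (simp only: atLeast0AtMost sum.distrib sum_distrib_left)
    moreover have "fps_const (- p1 z) * (?A' * ?B) + fps_const (p2 z) * (?A * ?B')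
      = (1 - fps_X) * (fps_const (a * (p2 z - p1 z)) * (fps_X * H z))"
    proof -
      \<comment> \<open>The factor \<open>1 - X\<close> comes from
        \<open>- P (1 - (1 - Q) X) + Q (1 - (1 - P) X) = (Q - P) (1 - X)\<close>.\<close>
      have ring: "- P * (c * X * A * ((1 - (1 - Q) * X) * B)) + Q * ((1 - (1 - P) * X) * A * (c * X * B))
        = (1 - X) * (c * (Q - P) * (X * (A * B)))" for P Q c X A B :: "real fps"
        by (simp add: algebra_simps)
      have const: "fps_const (- p1 z) = - fps_const (p1 z)" "fps_const (q1 z) = 1 - fps_const (p1 z)"
        "fps_const (q2 z) = 1 - fps_const (p2 z)"
        "fps_const (a * (p2 z - p1 z)) = fps_const a * (fps_const (p2 z) - fps_const (p1 z))"
        by (simp_all add: q1_def q2_def flip: fps_const_1_eq_1)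
      show ?thesis
        unfolding H_def negbin_fps_Suc_shape[of "q1 z" a, symmetric]
          negbin_fps_Suc_shape[of "q2 z" a, symmetric] const
        by (rule ring)
    qed
    ultimately show ?thesis
      by (simp only: sum_fps_nth_one_minus_X fps_mult_left_const_nth)
  qed
  have "F 0 \<le> F s"
  proof (rule DERIV_nonneg_imp_nondecreasing[OF s(1)])
    fix z assume z: "0 \<le> z" "z \<le> s"
    \<comment> \<open>Because of \<open>2 * s \<le> y' - y\<close>, the two success probabilities do
      not cross up to \<open>s\<close>, which fixes the sign of the derivative.\<close>
    then have p: "p1 z \<le> p2 z" "0 \<le> q1 z" "0 \<le> q2 z"
      using s y by (auto simp: p1_def p2_def q1_def q2_def)
    have "0 \<le> fps_nth (H z) k" for k
      unfolding H_def fps_mult_nth negbin_fps_def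
      using a p by (auto intro!: sum_nonneg mult_nonneg_nonneg simp: negbin_coeff_pos less_imp_le)
    then have "0 \<le> fps_nth (fps_X * H z) m"
      by (cases m) auto
    then show "\<exists>d. (F has_real_derivative d) (at z) \<and> 0 \<le> d"
      using deriv[of z] a p
      by (intro exI[of _ "E * (a * (p2 z - p1 z) * fps_nth (fps_X * H z) m)"]) (auto simp: E_def)
  qed
  then show ?thesis
    by (simp add: F_def p1_def p2_def)
qed

section \<open>Negative binomial laws as measures on the real line\<close>

definition negbin_pmf :: "real \<Rightarrow> real \<Rightarrow> nat pmf" where
  "negbin_pmf a y = embed_pmf (negbin_prob a (exp y))"

definition negbin_law :: "real \<Rightarrow> real \<Rightarrow> real measure" where
  "negbin_law a y = distr (negbin_pmf a y) borel real"

lemma pmf_negbin: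
  assumes "0 < a" "y < 0"
  shows "pmf (negbin_pmf a y) k = negbin_prob a (exp y) k"
  unfolding negbin_pmf_def
proof (rule pmf_embed_pmf)
  show nn: "0 \<le> negbin_prob a (exp y) k" for k
    using assms by (intro negbin_prob_nonneg) auto
  show "(\<integral>\<^sup>+k. ennreal (negbin_prob a (exp y) k) \<partial>count_space UNIV) = 1"
    using suminf_ennreal_eq[OF nn negbin_prob_sums[OF assms(2)]] by (simp add: nn_integral_count_space_nat)
qed

lemma real_distribution_distr_pmf: "real_distribution (distr (measure_pmf P) borel real)"
  by (auto simp: real_distribution_def real_distribution_axioms_def intro!: measure_pmf.prob_space_distr)

lemma distr_pmf_convolution:
  fixes P Q :: "nat pmf"
  shows "(distr P borel real \<star> distr Q borel real) =
    distr (map_pmf (\<lambda>(i, j). i + j) (pair_pmf P Q)) borel real"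
proof (rule measure_eqI)
  fix A assume "A \<in> sets (distr P borel real \<star> distr Q borel real)"
  then have [measurable]: "A \<in> sets borel" by simp
  interpret P: real_distribution "distr P borel real" by (rule real_distribution_distr_pmf)
  interpret Q: real_distribution "distr Q borel real" by (rule real_distribution_distr_pmf)
  have "emeasure (distr P borel real \<star> distr Q borel real) A =
      (\<integral>\<^sup>+x. \<integral>\<^sup>+y. indicator A (x + y) \<partial>distr Q borel real \<partial>distr P borel real)"
    by (rule convolution_emeasure') (simp_all add: P.finite_measure_axioms Q.finite_measure_axioms)
  also have "\<dots> = (\<integral>\<^sup>+i. \<integral>\<^sup>+j. indicator A (real i + real j) \<partial>Q \<partial>P)"
    by (subst nn_integral_distr; (subst nn_integral_distr)?; simp)
  also have "\<dots> = emeasure (distr (map_pmf (\<lambda>(i, j). i + j) (pair_pmf P Q)) borel real) A"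
    by (subst nn_integral_indicator[symmetric])
       (auto simp: nn_integral_distr nn_integral_pair_pmf' simp del: nn_integral_indicator)
  finally show "emeasure (distr P borel real \<star> distr Q borel real) A =
    emeasure (distr (map_pmf (\<lambda>(i, j). i + j) (pair_pmf P Q)) borel real) A" .
qed simp

lemma pmf_map_add_pair_pmf:
  fixes P Q :: "nat pmf"
  shows "pmf (map_pmf (\<lambda>(i, j). i + j) (pair_pmf P Q)) m = (\<Sum>i\<le>m. pmf P i * pmf Q (m - i))"
proof -
  have "(\<lambda>(i, j). i + j) -` {m} = (\<lambda>i. (i, m - i)) ` {..m}" by auto
  then have "pmf (map_pmf (\<lambda>(i, j). i + j) (pair_pmf P Q)) m =
      (\<Sum>x\<in>(\<lambda>i. (i, m - i)) ` {..m}. pmf (pair_pmf P Q) x)"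
    unfolding pmf_map by (simp add: measure_measure_pmf_finite)
  also have "\<dots> = (\<Sum>i\<le>m. pmf P i * pmf Q (m - i))"
    by (subst sum.reindex) (auto simp: inj_on_def pmf_pair)
  finally show ?thesis .
qed

lemma dist_le_distr_pmf:
  fixes P Q :: "nat pmf"
  assumes "\<And>m. (\<Sum>k\<le>m. pmf Q k) \<le> (\<Sum>k\<le>m. pmf P k)"
  shows "dist_le (distr P borel real) (distr Q borel real)"
  unfolding dist_le_def
proof
  fix t :: real
  have tail: "measure (distr R borel real) {t..} = 1 - measure R {n. real n < t}" for R :: "nat pmf"
  proof -
    have "real -` {t..} = UNIV - {n. real n < t}" by auto
    then show ?thesis
      using measure_pmf.prob_compl[of "{n. real n < t}" R] by (simp add: measure_distr)
  qed
  have "measure Q {n. real n < t} \<le> measure P {n. real n < t}"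
  proof (cases "0 < t")
    case True
    \<comment> \<open>The largest integer strictly below \<open>t\<close>. The strictness matters
      because the complement of the closed tail is \<open>n < t\<close>.\<close>
    define m where "m = nat (\<lceil>t\<rceil> - 1)"
    have "real n < t \<longleftrightarrow> n \<le> m" for n
    proof -
      have "real n < t \<longleftrightarrow> int n < \<lceil>t\<rceil>"
        by (simp add: less_ceiling_iff)
      also have "\<dots> \<longleftrightarrow> n \<le> m"
        using True unfolding m_def by (subst le_nat_iff) auto
      finally show ?thesis .
    qed
    then have "{n. real n < t} = {..m}" by auto
    then show ?thesis
      using assms[of m] by (simp add: measure_measure_pmf_finite)
  next
    case False
    then have "{n. real n < t} = {}" by auto
    then show ?thesis by simp
  qed
  then show "measure (distr P borel real) {t..} \<le> measure (distr Q borel real) {t..}"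
    by (simp add: tail)
qed

text \<open>The bound is strictly negative because \<open>y = 0\<close> means \<open>p = 1\<close>,
  outside the range of \<open>pmf_negbin\<close>.\<close>

lemma rc_family_negbin:
  assumes c: "c < 0"
  shows "rc_family negbin_law c"
proof (rule rc_family.intro)
  fix x y :: real
  show "real_distribution (negbin_law x y)"
    unfolding negbin_law_def by (rule real_distribution_distr_pmf)
  show "measure (negbin_law x y) {0..} = 1"
    unfolding negbin_law_def
    by (simp add: measure_distr vimage_def measure_pmf.prob_space[simplified])
next
  fix a b y :: real
  assume "0 < a" "0 < b" "y \<le> c"
  then have "map_pmf (\<lambda>(i, j). i + j) (pair_pmf (negbin_pmf a y) (negbin_pmf b y)) = negbin_pmf (a + b) y"
    using c by (intro pmf_eqI) (simp add: pmf_map_add_pair_pmf pmf_negbin negbin_prob_convolution)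
  then show "(negbin_law a y \<star> negbin_law b y) = negbin_law (a + b) y"
    unfolding negbin_law_def distr_pmf_convolution by simp
next
  fix x y y' :: real
  assume "0 < x" "y \<le> y'" "y' \<le> c"
  then show "dist_le (negbin_law x y') (negbin_law x y)"
    unfolding negbin_law_def using c
    by (intro dist_le_distr_pmf) (simp add: pmf_negbin negbin_cdf_mono)
next
  fix x y y' s :: real
  assume "0 < x" "y \<le> y'" "y' \<le> c" "0 \<le> s" "2 * s \<le> y' - y"
  then show "dist_le (negbin_law x (y + s) \<star> negbin_law x (y' - s)) (negbin_law x y \<star> negbin_law x y')"
    unfolding negbin_law_def distr_pmf_convolution using c
    by (intro dist_le_distr_pmf) (simp add: pmf_negbin pmf_map_add_pair_pmf negbin_pair_cdf_mono)
qed

lemma (in prob_space) distr_negbin: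
  assumes X: "random_variable (count_space UNIV) X" and a: "0 < a" "0 < p" "p < 1"
    and prob: "\<And>k. prob {\<omega> \<in> space M. X \<omega> = k} = negbin_prob a p k"
  shows "distr M borel (\<lambda>\<omega>. real (X \<omega>)) = negbin_law a (ln p)"
proof -
  have "distr M (count_space UNIV) X = measure_pmf (negbin_pmf a (ln p))"
  proof (rule measure_eqI_countable[of _ UNIV])
    fix k :: nat assume "k \<in> UNIV"
    have "emeasure (distr M (count_space UNIV) X) {k} = ennreal (prob {\<omega> \<in> space M. X \<omega> = k})"
      using X by (subst emeasure_distr) (auto simp: emeasure_eq_measure vimage_def Int_def conj_commute)
    then show "emeasure (distr M (count_space UNIV) X) {k} = emeasure (negbin_pmf a (ln p)) {k}"
      using a by (simp add: prob emeasure_pmf_single pmf_negbin)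
  qed auto
  then have "negbin_law a (ln p) = distr (distr M (count_space UNIV) X) borel real"
    unfolding negbin_law_def by simp
  also have "\<dots> = distr M borel (\<lambda>\<omega>. real (X \<omega>))"
    using X by (subst distr_distr) (auto simp: o_def)
  finally show ?thesis ..
qed

section \<open>Gamma laws\<close>

definition gamma_law :: "real \<Rightarrow> real \<Rightarrow> real measure" where
  "gamma_law a y = density lborel (\<lambda>t. ennreal (gamma_density a (exp y) t))"

lemma borel_measurable_gamma_density [measurable]: "gamma_density a b \<in> borel_measurable borel"
  unfolding gamma_density_def[abs_def] by measurable

lemma gamma_density_nonneg: "0 < a \<Longrightarrow> 0 \<le> gamma_density a b t"
  by (simp add: gamma_density_def Gamma_real_pos less_imp_le)

lemma gamma_density_nonpos: "t \<le> 0 \<Longrightarrow> gamma_density a b t = 0"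
  by (auto simp: gamma_density_def)

lemma gamma_density_scale: "0 < b \<Longrightarrow> gamma_density a b t = b * gamma_density a 1 (b * t)"
  using powr_add[of b 1 "a - 1"] by (simp add: gamma_density_def powr_mult mult_less_0_iff)

text \<open>Standardisation: a gamma variable of rate \<open>b\<close> is a variable of rate 1
  divided by \<open>b\<close>. The dependence on the rate thereby passes from the density to the
  integrand.\<close>

lemma nn_integral_gamma_density:
  assumes b: "0 < b" and [measurable]: "f \<in> borel_measurable borel"
  shows "(\<integral>\<^sup>+t. ennreal (gamma_density a b t) * f t \<partial>lborel) =
    (\<integral>\<^sup>+x. ennreal (gamma_density a 1 x) * f (x / b) \<partial>lborel)"
proof -
  have "(\<integral>\<^sup>+x. ennreal (gamma_density a 1 x) * f (x / b) \<partial>lborel) =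
      ennreal b * (\<integral>\<^sup>+t. ennreal (gamma_density a 1 (b * t)) * f t \<partial>lborel)"
    using b by (subst nn_integral_real_affine[where t = 0 and c = b]) simp_all
  also have "\<dots> = (\<integral>\<^sup>+t. ennreal (gamma_density a b t) * f t \<partial>lborel)"
    using b unfolding gamma_density_scale[OF b, of a]
    by (subst nn_integral_cmult[symmetric]) (simp_all add: ennreal_mult' mult.assoc)
  finally show ?thesis ..
qed

lemma nn_integral_gamma_density_1:
  assumes a: "0 < a"
  shows "(\<integral>\<^sup>+x. ennreal (gamma_density a 1 x) \<partial>lborel) = 1"
proof -
  have G: "0 < Gamma a" using a by (rule Gamma_real_pos)
  have "(\<integral>\<^sup>+x. ennreal (gamma_density a 1 x) \<partial>lborel) =
      (\<integral>\<^sup>+x. ennreal (1 / Gamma a) * ennreal (indicator {0..} x * x powr (a - 1) / exp x) \<partial>lborel)"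
  proof (intro nn_integral_cong)
    fix x :: real
    have "gamma_density a 1 x = 1 / Gamma a * (indicator {0..} x * x powr (a - 1) / exp x)"
      by (simp add: gamma_density_def indicator_def exp_minus divide_inverse)
    then show "ennreal (gamma_density a 1 x) =
        ennreal (1 / Gamma a) * ennreal (indicator {0..} x * x powr (a - 1) / exp x)"
      using G ennreal_mult'[of "1 / Gamma a"] by (metis less_imp_le zero_less_divide_1_iff)
  qed
  also have "\<dots> = ennreal (1 / Gamma a) * ennreal (Gamma a)"
    using a by (subst nn_integral_cmult) (simp_all add: Gamma_conv_nn_integral_real)
  also have "\<dots> = ennreal (1 / Gamma a * Gamma a)"
    using G by (intro ennreal_mult'[symmetric]) simp
  also have "1 / Gamma a * Gamma a = 1"
    using G by simp
  finally show ?thesis by simp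
qed

lemma emeasure_gamma_law:
  assumes "A \<in> sets borel"
  shows "emeasure (gamma_law a y) A =
    (\<integral>\<^sup>+x. ennreal (gamma_density a 1 x) * indicator A (x / exp y) \<partial>lborel)"
  using assms unfolding gamma_law_def
  by (subst emeasure_density) (simp_all add: nn_integral_gamma_density[of "exp y"])

lemma real_distribution_gamma_law:
  assumes "0 < a"
  shows "real_distribution (gamma_law a y)"
proof -
  have "emeasure (gamma_law a y) UNIV = 1"
    using assms by (simp add: emeasure_gamma_law nn_integral_gamma_density_1)
  then have "prob_space (gamma_law a y)"
    by (intro prob_spaceI) (simp add: gamma_law_def)
  then show ?thesis
    by (simp add: real_distribution_def real_distribution_axioms_def gamma_law_def)
qed

section \<open>The convolution semigroup of gamma laws\<close>

lemma nn_integral_Beta_real: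
  assumes "0 < a" "0 < (b :: real)"
  shows "(\<integral>\<^sup>+u. ennreal (indicator {0..1} u * (u powr (b - 1) * (1 - u) powr (a - 1))) \<partial>lborel) =
    ennreal (Beta a b)"
  using nn_integral_has_integral_lebesgue[OF _ has_integral_Beta_real[OF assms(2,1)]]
  by (simp add: Beta_commute)

lemma gamma_density_convolution:
  assumes a: "0 < a" and b: "0 < b" and r: "0 < r"
  shows "(\<integral>\<^sup>+y. ennreal (gamma_density a r (x - y)) * ennreal (gamma_density b r y) \<partial>lborel) =
    ennreal (gamma_density (a + b) r x)"
proof (cases "0 < x")
  case False
  then have "gamma_density a r (x - y) = 0 \<or> gamma_density b r y = 0" for y
    by (cases "y \<le> 0") (auto simp: gamma_density_nonpos)
  then have zero: "ennreal (gamma_density a r (x - y)) * ennreal (gamma_density b r y) = 0" for y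
    by (metis ennreal_0 mult_zero_left mult_zero_right)
  show ?thesis unfolding zero using False by (simp add: gamma_density_nonpos)
next
  case True
  \<comment> \<open>\<open>C\<close> collects what does not depend on \<open>u\<close> after the
    substitution \<open>y = x * u\<close>; the remaining integrand is that of the Beta function. The
    substitution contributes one more factor \<open>x\<close>, which raises the exponent
    \<open>a + b - 2\<close> to \<open>a + b - 1\<close>.\<close>
  define C where "C = r powr (a + b) / (Gamma a * Gamma b) * exp (- r * x) * x powr (a + b - 2)"
  have pos: "0 < Gamma a" "0 < Gamma b" "0 < Gamma (a + b)"
    using a b by (simp_all add: Gamma_real_pos)
  then have C: "0 \<le> C" by (simp add: C_def)
  have *: "gamma_density a r (x - x * u) * gamma_density b r (x * u) =
      C * (indicator {0..1} u * (u powr (b - 1) * (1 - u) powr (a - 1)))" for u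
  proof (cases "u \<in> {0..1}")
    case u: True
    have x_diff: "x - x * u = x * (1 - u)"
      by (simp add: right_diff_distrib)
    have e: "exp (- r * x) = exp (- r * (x * (1 - u))) * exp (- r * (x * u))"
      unfolding exp_add[symmetric] by (simp add: algebra_simps)
    have p: "x powr (a + b - 2) = x powr (a - 1) * x powr (b - 1)"
      unfolding powr_add[symmetric] by (simp add: algebra_simps)
    have nonneg: "\<not> x * (1 - u) < 0" "\<not> x * u < 0"
      using u True by (simp_all add: not_less)
    have "gamma_density a r (x - x * u) = r powr a * (x powr (a - 1) * (1 - u) powr (a - 1)) / Gamma a * exp (- r * (x * (1 - u)))"
      unfolding x_diff gamma_density_def if_not_P[OF nonneg(1)] using u True by (simp add: powr_mult)
    moreover have "gamma_density b r (x * u) = r powr b * (x powr (b - 1) * u powr (b - 1)) / Gamma b * exp (- r * (x * u))"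
      unfolding gamma_density_def if_not_P[OF nonneg(2)] using u True by (simp add: powr_mult)
    ultimately show ?thesis
      using u unfolding C_def e p powr_add[of r] by (simp only: indicator_simps) simp
  next
    case False
    then consider "u < 0" | "1 < u" by fastforce
    then have "gamma_density a r (x - x * u) = 0 \<or> gamma_density b r (x * u) = 0"
    proof cases
      case 1
      then have "x * u \<le> 0" using True by (simp add: mult_le_0_iff)
      then show ?thesis by (simp add: gamma_density_nonpos)
    next
      case 2
      then have "x - x * u \<le> 0" using True by simp
      then show ?thesis by (simp add: gamma_density_nonpos)
    qed
    then show ?thesis using False by auto
  qed
  have "(\<integral>\<^sup>+y. ennreal (gamma_density a r (x - y)) * ennreal (gamma_density b r y) \<partial>lborel) =
     ennreal x * (\<integral>\<^sup>+u. ennreal (gamma_density a r (x - x * u) * gamma_density b r (x * u)) \<partial>lborel)"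
    using True a b by (subst nn_integral_real_affine[where t = 0 and c = x])
      (simp_all add: gamma_density_nonneg ennreal_mult)
  also have "\<dots> = ennreal x * (ennreal C * ennreal (Beta a b))"
    unfolding * ennreal_mult'[OF C] nn_integral_Beta_real[OF a b, symmetric]
    by (subst nn_integral_cmult) simp_all
  also have "\<dots> = ennreal (x * (C * Beta a b))"
    using True C by (simp add: ennreal_mult')
  also have "x * (C * Beta a b) = gamma_density (a + b) r x"
  proof -
    have "x * x powr (a + b - 2) = x powr (a + b - 1)"
      using True powr_add[of x 1 "a + b - 2"] by simp
    then show ?thesis
      using True pos by (simp add: gamma_density_def C_def Beta_def)
  qed
  finally show ?thesis .
qed

lemma gamma_law_semigroup:
  assumes "0 < a" "0 < b"
  shows "(gamma_law a y \<star> gamma_law b y) = gamma_law (a + b) y"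
proof -
  interpret A: real_distribution "gamma_law a y" using assms(1) by (rule real_distribution_gamma_law)
  interpret B: real_distribution "gamma_law b y" using assms(2) by (rule real_distribution_gamma_law)
  show ?thesis
    using A.finite_measure_axioms B.finite_measure_axioms assms unfolding gamma_law_def
    by (subst convolution_density) (simp_all add: gamma_density_convolution)
qed

text \<open>The linear map \<open>(x, y) \<mapsto> (y / \<kappa>, \<kappa> x)\<close> has
  determinant \<open>- 1\<close>. It is resolved into two one-dimensional scalings, whose factors
  cancel, and an exchange of the integrals.\<close>

lemma nn_integral_swap_scale:
  fixes F :: "real \<Rightarrow> real \<Rightarrow> ennreal"
  assumes \<kappa>: "0 < \<kappa>" and [measurable]: "case_prod F \<in> borel_measurable (borel \<Otimes>\<^sub>M borel)"
  shows "(\<integral>\<^sup>+x. \<integral>\<^sup>+y. F (y / \<kappa>) (\<kappa> * x) \<partial>lborel \<partial>lborel) = (\<integral>\<^sup>+x. \<integral>\<^sup>+y. F x y \<partial>lborel \<partial>lborel)"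
proof -
  have "(\<integral>\<^sup>+y. F (y / \<kappa>) (\<kappa> * x) \<partial>lborel) = ennreal \<kappa> * (\<integral>\<^sup>+u. F u (\<kappa> * x) \<partial>lborel)" for x
    using \<kappa> by (subst nn_integral_real_affine[where t = 0 and c = \<kappa>]) simp_all
  then have "(\<integral>\<^sup>+x. \<integral>\<^sup>+y. F (y / \<kappa>) (\<kappa> * x) \<partial>lborel \<partial>lborel) =
      ennreal \<kappa> * (\<integral>\<^sup>+x. \<integral>\<^sup>+u. F u (\<kappa> * x) \<partial>lborel \<partial>lborel)"
    by (simp add: nn_integral_cmult)
  also have "\<dots> = (\<integral>\<^sup>+v. \<integral>\<^sup>+u. F u v \<partial>lborel \<partial>lborel)"
    using \<kappa> by (subst (2) nn_integral_real_affine[where t = 0 and c = \<kappa>]) simp_all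
  also have "\<dots> = (\<integral>\<^sup>+u. \<integral>\<^sup>+v. F u v \<partial>lborel \<partial>lborel)"
    by (rule lborel_pair.Fubini') simp
  finally show ?thesis .
qed

text \<open>Both variables are standardised to rate 1. For a fixed shape the joint density is then
  the same for all parameters, and only the event depends on \<open>y\<close> and
  \<open>y'\<close>.\<close>

lemma emeasure_gamma_law_convolution:
  assumes a: "0 < a"
  shows "emeasure (gamma_law a y \<star> gamma_law a y') {t..} =
    (\<integral>\<^sup>+x1. \<integral>\<^sup>+x2. ennreal (gamma_density a 1 x1 * gamma_density a 1 x2) *
      indicator {z. t \<le> fst z / exp y + snd z / exp y'} (x1, x2) \<partial>lborel \<partial>lborel)"
proof -
  have "emeasure (gamma_law a y \<star> gamma_law a y') {t..} =
      (\<integral>\<^sup>+x. emeasure (gamma_law a y') {t - x..} \<partial>gamma_law a y)"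
    using a by (intro emeasure_convolution_atLeast real_distribution_gamma_law)
  also have "\<dots> = (\<integral>\<^sup>+x. (\<integral>\<^sup>+x2. ennreal (gamma_density a 1 x2) *
      indicator {z. t \<le> fst z + snd z / exp y'} (x, x2) \<partial>lborel) \<partial>gamma_law a y)"
    by (subst emeasure_gamma_law) (auto intro!: nn_integral_cong simp: indicator_def algebra_simps)
  also have "\<dots> = (\<integral>\<^sup>+x1. ennreal (gamma_density a (exp y) x1) * (\<integral>\<^sup>+x2. ennreal (gamma_density a 1 x2) *
      indicator {z. t \<le> fst z + snd z / exp y'} (x1, x2) \<partial>lborel) \<partial>lborel)"
    unfolding gamma_law_def by (subst nn_integral_density) simp_all
  also have "\<dots> = (\<integral>\<^sup>+x1. ennreal (gamma_density a 1 x1) * (\<integral>\<^sup>+x2. ennreal (gamma_density a 1 x2) *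
      indicator {z. t \<le> fst z + snd z / exp y'} (x1 / exp y, x2) \<partial>lborel) \<partial>lborel)"
    by (subst nn_integral_gamma_density) simp_all
  also have "\<dots> = (\<integral>\<^sup>+x1. \<integral>\<^sup>+x2. ennreal (gamma_density a 1 x1 * gamma_density a 1 x2) *
      indicator {z. t \<le> fst z / exp y + snd z / exp y'} (x1, x2) \<partial>lborel \<partial>lborel)"
    using a by (subst nn_integral_cmult[symmetric])
      (auto intro!: nn_integral_cong simp: indicator_def ennreal_mult gamma_density_nonneg)
  finally show ?thesis .
qed

text \<open>With \<open>\<kappa> = exp (y' - s - y)\<close>, the map \<open>(x1, x2) \<mapsto> (x2 / \<kappa>, \<kappa> x1)\<close> preserves
  Lebesgue measure and the product \<open>x1 x2\<close>, and exchanges the event \<open>B\<close> that the spread-out sum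
  exceeds \<open>t\<close> with the corresponding event \<open>C\<close> of the other sum. On \<open>B - C\<close> we have
  \<open>x2 \<le> \<kappa> x1\<close>, so that the map moves points to smaller joint density.\<close>

lemma gamma_law_spread:
  assumes a: "0 < a" and s: "0 \<le> s" "2 * s \<le> y' - y"
  shows "dist_le (gamma_law a (y + s) \<star> gamma_law a (y' - s)) (gamma_law a y \<star> gamma_law a y')"
  unfolding dist_le_def
proof
  fix t :: real
  define \<kappa> where "\<kappa> = exp (y' - s - y)"
  define \<rho> where "\<rho> x1 x2 = gamma_density a 1 x1 * gamma_density a 1 x2" for x1 x2
  define B where "B = {z :: real \<times> real. t \<le> fst z / exp y + snd z / exp y'}"
  define C where "C = {z :: real \<times> real. t \<le> fst z / exp (y + s) + snd z / exp (y' - s)}"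
  have \<kappa>: "1 \<le> \<kappa>" "0 < \<kappa>" using s by (auto simp: \<kappa>_def)
  have "{z \<in> space (borel \<Otimes>\<^sub>M borel). t \<le> fst z / u + snd z / v} \<in> sets (borel \<Otimes>\<^sub>M borel)"
    for u v :: real
    by measurable
  then have [measurable]: "B \<in> sets (borel \<Otimes>\<^sub>M borel)" "C \<in> sets (borel \<Otimes>\<^sub>M borel)"
    by (simp_all add: space_pair_measure B_def C_def)
  \<comment> \<open>These identities dictate \<kappa>: the rate at \<open>y' - s\<close> relative to
    the one at \<open>y\<close> must equal the rate at \<open>y'\<close> relative to the one at
    \<open>y + s\<close> for the map to exchange the two events.\<close>
  have e: "exp (y' - s) = \<kappa> * exp y" "exp y' = \<kappa> * exp (y + s)"
    by (simp_all add: \<kappa>_def flip: exp_add)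
  have swap_B: "(x2 / \<kappa>, \<kappa> * x1) \<in> B \<longleftrightarrow> (x1, x2) \<in> C"
    and swap_C: "(x2 / \<kappa>, \<kappa> * x1) \<in> C \<longleftrightarrow> (x1, x2) \<in> B" for x1 x2
    unfolding B_def C_def e using \<kappa> by (simp_all add: add.commute)
  have \<rho>_nonneg: "0 \<le> \<rho> x1 x2" for x1 x2
    using a by (simp add: \<rho>_def gamma_density_nonneg)
  have \<rho>_mono: "\<rho> (x2 / \<kappa>) (\<kappa> * x1) \<le> \<rho> x1 x2" if "x2 \<le> \<kappa> * x1" for x1 x2
  proof (cases "0 < x1 \<and> 0 < x2")
    case True
    \<comment> \<open>As the product of the coordinates is preserved, the densities are compared
      through the exponents alone. The sum grows under the map by
      \<open>(\<kappa> - 1) (\<kappa> x1 - x2) / \<kappa>\<close>.\<close>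
    have "0 \<le> (\<kappa> - 1) * (\<kappa> * x1 - x2)"
      using that \<kappa> by simp
    then have "\<kappa> * (x1 + x2) \<le> \<kappa> * (x2 / \<kappa> + \<kappa> * x1)"
      using \<kappa> by (simp add: algebra_simps)
    then have "x1 + x2 \<le> x2 / \<kappa> + \<kappa> * x1"
      using \<kappa> by simp
    then have exp_le: "exp (- (x2 / \<kappa> + \<kappa> * x1)) \<le> exp (- (x1 + x2))"
      by simp
    have dens: "\<rho> u v = (u * v) powr (a - 1) / (Gamma a)\<^sup>2 * exp (- (u + v))"
      if "0 < u" "0 < v" for u v
      using that by (simp add: \<rho>_def gamma_density_def powr_mult power2_eq_square exp_diff exp_minus field_simps)
    have "\<rho> (x2 / \<kappa>) (\<kappa> * x1) = (x1 * x2) powr (a - 1) / (Gamma a)\<^sup>2 * exp (- (x2 / \<kappa> + \<kappa> * x1))"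
      using True \<kappa> by (subst dens) (simp_all add: mult.commute)
    also have "\<dots> \<le> (x1 * x2) powr (a - 1) / (Gamma a)\<^sup>2 * exp (- (x1 + x2))"
      by (rule mult_left_mono[OF exp_le]) simp
    also have "\<dots> = \<rho> x1 x2"
      using True by (simp only: dens)
    finally show ?thesis .
  next
    case False
    then have "x2 / \<kappa> \<le> 0 \<or> \<kappa> * x1 \<le> 0"
      using \<kappa> by (auto simp: divide_le_0_iff mult_le_0_iff)
    then have "\<rho> (x2 / \<kappa>) (\<kappa> * x1) = 0"
      by (auto simp: \<rho>_def gamma_density_nonpos)
    then show ?thesis by (simp add: \<rho>_nonneg)
  qed
  have diff: "(x1, x2) \<in> B - C \<Longrightarrow> x2 \<le> \<kappa> * x1" and diff': "(x1, x2) \<in> C - B \<Longrightarrow> \<kappa> * x1 \<le> x2" for x1 x2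
  proof -
    \<comment> \<open>The coefficients of the two linear forms differ by \<open>D * \<kappa>\<close>
      in \<open>x1\<close> and by \<open>- D\<close> in \<open>x2\<close>, so the forms differ by a
      multiple of \<open>\<kappa> * x1 - x2\<close>.\<close>
    define D where "D = (1 / exp y - 1 / exp (y + s)) / \<kappa>"
    have D: "0 \<le> D"
      using s \<kappa> by (auto simp: D_def field_simps)
    have "x1 / exp y + x2 / exp y' - (x1 / exp (y + s) + x2 / exp (y' - s)) = D * (\<kappa> * x1 - x2)"
      unfolding D_def e using \<kappa> by (simp add: field_simps)
    then have *: "x1 / exp y + x2 / exp y' = x1 / exp (y + s) + x2 / exp (y' - s) + D * (\<kappa> * x1 - x2)"
      by simp
    show "x2 \<le> \<kappa> * x1" if "(x1, x2) \<in> B - C"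
    proof -
      have "0 < D * (\<kappa> * x1 - x2)"
        using that * by (simp add: B_def C_def)
      then show ?thesis
        using D by (simp add: zero_less_mult_iff)
    qed
    show "\<kappa> * x1 \<le> x2" if "(x1, x2) \<in> C - B"
    proof -
      have "D * (\<kappa> * x1 - x2) < 0"
        using that * by (simp add: B_def C_def)
      then show ?thesis
        using D by (simp add: mult_less_0_iff)
    qed
  qed
  define I where "I A = (\<integral>\<^sup>+x1. \<integral>\<^sup>+x2. ennreal (\<rho> x1 x2) * indicator A (x1, x2) \<partial>lborel \<partial>lborel)"
    for A :: "(real \<times> real) set"
  define J where "J A = (\<integral>\<^sup>+x1. \<integral>\<^sup>+x2. ennreal (\<rho> (x2 / \<kappa>) (\<kappa> * x1)) * indicator A (x1, x2) \<partial>lborel \<partial>lborel)"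
    for A :: "(real \<times> real) set"
  have [measurable]: "case_prod \<rho> \<in> borel_measurable (borel \<Otimes>\<^sub>M borel)"
    unfolding \<rho>_def by measurable
  have J_C: "J C = I B"
    unfolding I_def J_def
    by (subst nn_integral_swap_scale[OF \<kappa>(2), symmetric])
       (auto intro!: nn_integral_cong simp: indicator_def swap_B)
  have J_B: "J B = I C"
    unfolding I_def J_def
    by (subst nn_integral_swap_scale[OF \<kappa>(2), symmetric])
       (auto intro!: nn_integral_cong simp: indicator_def swap_C)
  \<comment> \<open>With \<rho>' the density at the image point, this is
    \<open>(\<rho> - \<rho>') (1_B - 1_C) \<ge> 0\<close>, written without subtraction for
    \<open>ennreal\<close>. Integrating it and using \<open>J_B\<close> and \<open>J_C\<close> gives
    twice the desired inequality.\<close>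
  have pointwise: "ennreal (\<rho> x1 x2) * indicator C (x1, x2) + ennreal (\<rho> (x2 / \<kappa>) (\<kappa> * x1)) * indicator B (x1, x2)
    \<le> ennreal (\<rho> x1 x2) * indicator B (x1, x2) + ennreal (\<rho> (x2 / \<kappa>) (\<kappa> * x1)) * indicator C (x1, x2)" for x1 x2
  proof -
    \<comment> \<open>The map is an involution, so the reverse comparison is
      \<open>\<rho>_mono\<close> at the image point.\<close>
    have "\<rho> x1 x2 \<le> \<rho> (x2 / \<kappa>) (\<kappa> * x1)" if "\<kappa> * x1 \<le> x2"
      using \<rho>_mono[of "\<kappa> * x1" "x2 / \<kappa>"] that \<kappa> by simp
    then show ?thesis
      using \<rho>_mono[of x2 x1] diff[of x1 x2] diff'[of x1 x2]
      by (auto simp: indicator_def ennreal_leI add.commute)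
  qed
  have "I C + J B \<le> I B + J C"
    unfolding I_def J_def
    by (simp flip: nn_integral_add add: nn_integral_mono pointwise)
  then have "I C + I C \<le> I B + I B" by (simp add: J_B J_C)
  moreover interpret X: real_distribution "gamma_law a (y + s) \<star> gamma_law a (y' - s)"
    using a by (intro real_distribution_convolution real_distribution_gamma_law)
  interpret Y: real_distribution "gamma_law a y \<star> gamma_law a y'"
    using a by (intro real_distribution_convolution real_distribution_gamma_law)
  have "I C = emeasure (gamma_law a (y + s) \<star> gamma_law a (y' - s)) {t..}"
    "I B = emeasure (gamma_law a y \<star> gamma_law a y') {t..}"
    using a by (simp_all add: emeasure_gamma_law_convolution I_def B_def C_def \<rho>_def)
  ultimately show "measure (gamma_law a (y + s) \<star> gamma_law a (y' - s)) {t..} \<le>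
      measure (gamma_law a y \<star> gamma_law a y') {t..}"
    by (simp add: X.emeasure_eq_measure Y.emeasure_eq_measure flip: ennreal_plus)
qed

lemma gamma_law_antimono:
  assumes a: "0 < a" and y: "y \<le> y'"
  shows "dist_le (gamma_law a y') (gamma_law a y)"
  unfolding dist_le_def
proof
  fix t :: real
  interpret X: real_distribution "gamma_law a y" using a by (rule real_distribution_gamma_law)
  interpret Y: real_distribution "gamma_law a y'" using a by (rule real_distribution_gamma_law)
  have "emeasure (gamma_law a y') {t..} \<le> emeasure (gamma_law a y) {t..}"
    unfolding emeasure_gamma_law[OF borel_closed[OF closed_atLeast]]
  proof (rule nn_integral_mono)
    fix x
    show "ennreal (gamma_density a 1 x) * indicator {t..} (x / exp y') \<le>
        ennreal (gamma_density a 1 x) * indicator {t..} (x / exp y)"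
    proof (cases "0 < x")
      case True
      then have "x / exp y' \<le> x / exp y"
        using y by (intro divide_left_mono) auto
      then show ?thesis by (auto simp: indicator_def)
    qed (simp add: gamma_density_nonpos)
  qed
  then show "measure (gamma_law a y') {t..} \<le> measure (gamma_law a y) {t..}"
    by (simp add: X.emeasure_eq_measure Y.emeasure_eq_measure)
qed

lemma measure_gamma_law_nonneg:
  assumes a: "0 < a"
  shows "measure (gamma_law a y) {0..} = 1"
proof -
  interpret X: real_distribution "gamma_law a y" using a by (rule real_distribution_gamma_law)
  have "emeasure (gamma_law a y) {0..} = (\<integral>\<^sup>+x. ennreal (gamma_density a 1 x) \<partial>lborel)"
    unfolding emeasure_gamma_law[OF borel_closed[OF closed_atLeast]]
    by (intro nn_integral_cong) (auto simp: indicator_def gamma_density_nonpos zero_le_divide_iff)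
  also have "\<dots> = 1" using a by (rule nn_integral_gamma_density_1)
  finally show ?thesis by (simp add: X.emeasure_eq_measure)
qed

lemma rc_family_gamma: "rc_family gamma_law c"
  by (rule rc_family.intro)
     (simp_all add: real_distribution_gamma_law measure_gamma_law_nonneg gamma_law_semigroup
       gamma_law_antimono gamma_law_spread)

lemma (in prob_space) distr_gamma:
  assumes "distributed M lborel X (\<lambda>t. ennreal (gamma_density a b t))" "0 < b"
  shows "distr M borel X = gamma_law a (ln b)"
  using distributed_distr_eq_density[OF assms(1)] assms(2)
  by (simp add: gamma_law_def cong: distr_cong)

section \<open>Comparison of sums\<close>

lemma st_le_iff_dist_le:
  assumes "Z \<in> borel_measurable M" "W \<in> borel_measurable N"
  shows "st_le M Z N W \<longleftrightarrow> dist_le (distr M borel Z) (distr N borel W)"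
  using assms unfolding st_le_def dist_le_def
  by (simp add: measure_distr vimage_def Int_def conj_commute)

text \<open>Truncating at the smallest shape and the largest second coordinate of the two endpoints
  leaves both endpoints unchanged, wherever the chain runs in between. The largest second coordinate
  is attained, so for success probabilities below 1 it is a negative bound.\<close>

lemma rc_family_dist_le:
  fixes x1 y1 x2 y2 :: "real ^ 'n::finite"
  assumes fam: "\<And>c. c \<in> range (($) y1) \<union> range (($) y2) \<Longrightarrow> rc_family D c"
    and pos: "\<And>i. 0 < x1 $ i" "\<And>i. 0 < x2 $ i"
    and rc: "rc_majorized (pair_class x1 y1) (pair_class x2 y2)"
  shows "dist_le (sum_law UNIV (\<lambda>i. D (x1 $ i) (y1 $ i))) (sum_law UNIV (\<lambda>i. D (x2 $ i) (y2 $ i)))"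
proof -
  define X Y where "X = range (($) x1) \<union> range (($) x2)" and "Y = range (($) y1) \<union> range (($) y2)"
  have fin: "finite X" "finite Y" "X \<noteq> {}" "Y \<noteq> {}" by (auto simp: X_def Y_def)
  have "0 < Min X" using fin pos by (auto simp: Min_gr_iff) (auto simp: X_def)
  moreover have "rc_family D (Max Y)" using fam Max_in[OF fin(2,4)] by (simp add: Y_def)
  ultimately interpret truncated_rc_family D "Max Y" "Min X"
    by (simp add: truncated_rc_family_def truncated_rc_family_axioms_def)
  show ?thesis
    by (rule dist_le_sum_law_rc_majorized[OF rc]) (use fin in \<open>auto intro!: Min_le Max_ge simp: X_def Y_def\<close>)
qed

lemma distr_sum_indep_negbin:
  assumes X: "indep_negbin M X \<alpha> p" and "\<And>i. \<alpha> $ i > 0" "\<And>i. 0 < p $ i \<and> p $ i < 1"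
  shows "distr M borel (\<lambda>\<omega>. \<Sum>i\<in>UNIV. real (X i \<omega>)) =
    sum_law UNIV (\<lambda>i. negbin_law (\<alpha> $ i) (vec_ln p $ i))"
    and "(\<lambda>\<omega>. \<Sum>i\<in>UNIV. real (X i \<omega>)) \<in> borel_measurable M"
proof -
  interpret prob_space M using X by (simp add: indep_negbin_def)
  have ind: "indep_vars (\<lambda>_. count_space UNIV) X UNIV"
    using X by (simp add: indep_negbin_def)
  then have [measurable]: "X i \<in> measurable M (count_space UNIV)" for i
    by (simp add: indep_vars_def)
  show "(\<lambda>\<omega>. \<Sum>i\<in>UNIV. real (X i \<omega>)) \<in> borel_measurable M"
    by measurable
  have "indep_vars (\<lambda>_. borel) (\<lambda>i \<omega>. real (X i \<omega>)) UNIV"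
    by (rule indep_vars_compose2[OF ind]) simp
  then have "distr M borel (\<lambda>\<omega>. \<Sum>i\<in>UNIV. real (X i \<omega>)) =
      sum_law UNIV (\<lambda>i. distr M borel (\<lambda>\<omega>. real (X i \<omega>)))"
    by (rule distr_sum_indep)
  also have "\<dots> = sum_law UNIV (\<lambda>i. negbin_law (\<alpha> $ i) (vec_ln p $ i))"
    using assms by (intro sum_law_cong) (auto simp: vec_ln_def indep_negbin_def intro!: distr_negbin)
  finally show "distr M borel (\<lambda>\<omega>. \<Sum>i\<in>UNIV. real (X i \<omega>)) =
    sum_law UNIV (\<lambda>i. negbin_law (\<alpha> $ i) (vec_ln p $ i))" .
qed

lemma distr_sum_indep_gamma:
  assumes Y: "indep_gamma M Y \<alpha> \<beta>" and "\<And>i. \<beta> $ i > 0"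
  shows "distr M borel (\<lambda>\<omega>. \<Sum>i\<in>UNIV. Y i \<omega>) =
    sum_law UNIV (\<lambda>i. gamma_law (\<alpha> $ i) (vec_ln \<beta> $ i))"
    and "(\<lambda>\<omega>. \<Sum>i\<in>UNIV. Y i \<omega>) \<in> borel_measurable M"
proof -
  interpret prob_space M using Y by (simp add: indep_gamma_def)
  have ind: "indep_vars (\<lambda>_. borel) Y UNIV"
    using Y by (simp add: indep_gamma_def)
  then have [measurable]: "Y i \<in> borel_measurable M" for i
    by (simp add: indep_vars_def)
  show "(\<lambda>\<omega>. \<Sum>i\<in>UNIV. Y i \<omega>) \<in> borel_measurable M"
    by measurable
  have "distr M borel (\<lambda>\<omega>. \<Sum>i\<in>UNIV. Y i \<omega>) = sum_law UNIV (\<lambda>i. distr M borel (Y i))"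
    using ind by (rule distr_sum_indep)
  also have "\<dots> = sum_law UNIV (\<lambda>i. gamma_law (\<alpha> $ i) (vec_ln \<beta> $ i))"
    using assms by (intro sum_law_cong) (auto simp: vec_ln_def indep_gamma_def intro!: distr_gamma)
  finally show "distr M borel (\<lambda>\<omega>. \<Sum>i\<in>UNIV. Y i \<omega>) =
    sum_law UNIV (\<lambda>i. gamma_law (\<alpha> $ i) (vec_ln \<beta> $ i))" .
qed

theorem theorem5p9:
  fixes \<alpha>1 \<alpha>2 p1 p2 \<beta>1 \<beta>2 :: "real ^ 'n::finite"
    and M1 :: "'a measure" and M2 :: "'b measure"
    and X1 :: "'n \<Rightarrow> 'a \<Rightarrow> nat" and X2 :: "'n \<Rightarrow> 'b \<Rightarrow> nat"
    and L1 :: "'c measure" and L2 :: "'d measure"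
    and Y1 :: "'n \<Rightarrow> 'c \<Rightarrow> real" and Y2 :: "'n \<Rightarrow> 'd \<Rightarrow> real"
  assumes "\<And>i. \<alpha>1 $ i > 0" and "\<And>i. \<alpha>2 $ i > 0"
    and "\<And>i. 0 < p1 $ i \<and> p1 $ i < 1" and "\<And>i. 0 < p2 $ i \<and> p2 $ i < 1"
    and "\<And>i. \<beta>1 $ i > 0" and "\<And>i. \<beta>2 $ i > 0"
  shows "(indep_negbin M1 X1 \<alpha>1 p1 \<and> indep_negbin M2 X2 \<alpha>2 p2 \<and>
            rc_majorized (pair_class \<alpha>1 (vec_ln p1)) (pair_class \<alpha>2 (vec_ln p2)) \<longrightarrow>
          st_le M1 (\<lambda>\<omega>. \<Sum>i\<in>UNIV. real (X1 i \<omega>)) M2 (\<lambda>\<omega>. \<Sum>i\<in>UNIV. real (X2 i \<omega>))) \<and>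
         (indep_gamma L1 Y1 \<alpha>1 \<beta>1 \<and> indep_gamma L2 Y2 \<alpha>2 \<beta>2 \<and>
            rc_majorized (pair_class \<alpha>1 (vec_ln \<beta>1)) (pair_class \<alpha>2 (vec_ln \<beta>2)) \<longrightarrow>
          st_le L1 (\<lambda>\<omega>. \<Sum>i\<in>UNIV. Y1 i \<omega>) L2 (\<lambda>\<omega>. \<Sum>i\<in>UNIV. Y2 i \<omega>))"
proof (intro conjI impI; elim conjE)
  assume X: "indep_negbin M1 X1 \<alpha>1 p1" "indep_negbin M2 X2 \<alpha>2 p2"
    and rc: "rc_majorized (pair_class \<alpha>1 (vec_ln p1)) (pair_class \<alpha>2 (vec_ln p2))"
  have "rc_family negbin_law c" if "c \<in> range (($) (vec_ln p1)) \<union> range (($) (vec_ln p2))" for c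
    using that assms(3,4) by (intro rc_family_negbin) (auto simp: vec_ln_def)
  from rc_family_dist_le[OF this assms(1,2) rc]
  show "st_le M1 (\<lambda>\<omega>. \<Sum>i\<in>UNIV. real (X1 i \<omega>)) M2 (\<lambda>\<omega>. \<Sum>i\<in>UNIV. real (X2 i \<omega>))"
    using distr_sum_indep_negbin[OF X(1) assms(1,3)] distr_sum_indep_negbin[OF X(2) assms(2,4)]
    by (simp add: st_le_iff_dist_le)
next
  assume Y: "indep_gamma L1 Y1 \<alpha>1 \<beta>1" "indep_gamma L2 Y2 \<alpha>2 \<beta>2"
    and rc: "rc_majorized (pair_class \<alpha>1 (vec_ln \<beta>1)) (pair_class \<alpha>2 (vec_ln \<beta>2))"
  from rc_family_dist_le[OF rc_family_gamma assms(1,2) rc]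
  show "st_le L1 (\<lambda>\<omega>. \<Sum>i\<in>UNIV. Y1 i \<omega>) L2 (\<lambda>\<omega>. \<Sum>i\<in>UNIV. Y2 i \<omega>)"
    using distr_sum_indep_gamma[OF Y(1) assms(5)] distr_sum_indep_gamma[OF Y(2) assms(6)]
    by (simp add: st_le_iff_dist_le)
qed

end
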